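(* The following statements are equivalent for any set $A\subseteq\omega$: (1) $A$ has either high or PA-complete Turing degree. (2) $A$ computes a function $B:\{0,1\}^*\to\omega$ such that $|\{x\in\{0,1\}^*:B(x)=n\}|\le 2^n$ for all $n$ and $B$ is dominated by all recursive upper bounds of $C$. (3) $A$ computes a function $F$ mapping every $n$ to a binary string of length $n$ such that for every recursive upper bound $\tilde C$ on $C$ and for almost all $n$, $\tilde C(F(n))\ge n$. (4) $A$ computes a $\{0,1\}$-valued function $g$ on $\omega$ such that for all infinite recursive subsets $R$ of the domain $\{n:\varphi_n(n)\text{ is defined}\}$ of the diagonal function, $g(n)\neq\varphi_n(n)$ for all but finitely many $n\in R$.
   Context: Fix an acceptable numbering $\varphi_0,\varphi_1,\dots$ of the partial recursive functions. $C$ denotes plain Kolmogorov complexity with respect to a fixed universal machine on binary strings. A function $u$ dominates a function $v$ if $u(x)\ge v(x)$ for all but finitely many $x$. A recursive upper bound on $C$ is a total recursive function $\tilde C:\{0,1\}^*\to\omega$ with $C(x)\le\tilde C(x)$ for all $x$. A set $A$ has high Turing degree if $A$ computes a function dominating every recursive function (equivalently, $A'\ge_T\emptyset''$). A total function $f:\omega\to\omega$ is diagonally nonrecursive (DNR) if $f(x)\neq\varphi_x(x)$ for every $x$ with $\varphi_x(x)$ defined. $A$ has PA-complete degree if $A$ computes a $\{0,1\}$-valued DNR function. *)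

theory Defs
  imports Complex_Main "HOL-Library.Nat_Bijection"
begin

section \<open>Oracle computability\<close>

text \<open>Least zero: undefined unless some value is zero and all earlier values are defined.\<close>

definition minimize :: "(nat \<rightharpoonup> nat) \<Rightarrow> nat option" where
  "minimize h =
     (if \<exists>n. h n = Some 0 \<and> (\<forall>m<n. h m \<noteq> None)
      then Some (LEAST n. h n = Some 0) else None)"

text \<open>
  The functions partial recursive in the oracle A. All functions are unary; several arguments are
  passed as one Cantor pair. For the empty oracle (whose characteristic function is the constant 0)
  these are the partial recursive functions.
\<close>

inductive partrec_in :: "nat set \<Rightarrow> (nat \<rightharpoonup> nat) \<Rightarrow> bool" for A where
  zero: "partrec_in A (\<lambda>_. Some 0)"
| succ: "partrec_in A (\<lambda>n. Some (Suc n))"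
| left: "partrec_in A (\<lambda>n. Some (fst (prod_decode n)))"
| right: "partrec_in A (\<lambda>n. Some (snd (prod_decode n)))"
| char_fun: "partrec_in A (\<lambda>n. Some (of_bool (n \<in> A)))"
| pair: "partrec_in A f \<Longrightarrow> partrec_in A g \<Longrightarrow>
    partrec_in A (\<lambda>n. Option.bind (f n) (\<lambda>a. Option.bind (g n) (\<lambda>b. Some (prod_encode (a, b)))))"
| comp: "partrec_in A f \<Longrightarrow> partrec_in A g \<Longrightarrow> partrec_in A (\<lambda>n. Option.bind (g n) f)"
| prim_rec: "partrec_in A f \<Longrightarrow> partrec_in A g \<Longrightarrow>
    partrec_in A (\<lambda>n. case prod_decode n of (a, k) \<Rightarrow>
      rec_nat (f a)
        (\<lambda>i r. Option.bind r (\<lambda>v. g (prod_encode (a, prod_encode (i, v))))) k)"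
| mu: "partrec_in A f \<Longrightarrow> partrec_in A (\<lambda>a. minimize (\<lambda>n. f (prod_encode (a, n))))"

text \<open>
  Computability over other domains, relative to injective codings of arguments and values
  (below: identity for numbers, Cantor pairing for pairs, \<open>str_code\<close> for binary strings).
\<close>

definition computes_partial ::
    "nat set \<Rightarrow> ('a \<Rightarrow> nat) \<Rightarrow> ('b \<Rightarrow> nat) \<Rightarrow> ('a \<rightharpoonup> 'b) \<Rightarrow> bool" where
  "computes_partial A enc enc' f \<longleftrightarrow>
     (\<exists>g. partrec_in A g \<and> (\<forall>x. g (enc x) = map_option enc' (f x)))"

definition computes ::
    "nat set \<Rightarrow> ('a \<Rightarrow> nat) \<Rightarrow> ('b \<Rightarrow> nat) \<Rightarrow> ('a \<Rightarrow> 'b) \<Rightarrow> bool" where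
  "computes A enc enc' f \<longleftrightarrow> computes_partial A enc enc' (\<lambda>x. Some (f x))"

abbreviation partial_recursive ::
    "('a \<Rightarrow> nat) \<Rightarrow> ('b \<Rightarrow> nat) \<Rightarrow> ('a \<rightharpoonup> 'b) \<Rightarrow> bool" where
  "partial_recursive \<equiv> computes_partial {}"

abbreviation recursive :: "('a \<Rightarrow> nat) \<Rightarrow> ('b \<Rightarrow> nat) \<Rightarrow> ('a \<Rightarrow> 'b) \<Rightarrow> bool" where
  "recursive \<equiv> computes {}"

definition recursive_set :: "nat set \<Rightarrow> bool" where
  "recursive_set R \<longleftrightarrow> recursive id id (\<lambda>n. of_bool (n \<in> R) :: nat)"

text \<open>
  An effective numbering to which every effective numbering reduces recursively; in particular
  every partial recursive function occurs in it.
\<close>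

definition acceptable :: "(nat \<Rightarrow> nat \<rightharpoonup> nat) \<Rightarrow> bool" where
  "acceptable \<phi> \<longleftrightarrow>
     partial_recursive prod_encode id (\<lambda>(e, x). \<phi> e x) \<and>
     (\<forall>\<psi> :: nat \<Rightarrow> nat \<rightharpoonup> nat. partial_recursive prod_encode id (\<lambda>(e, x). \<psi> e x) \<longrightarrow>
        (\<exists>t :: nat \<Rightarrow> nat. recursive id id t \<and> (\<forall>e. \<phi> (t e) = \<psi> e)))"


section \<open>Plain Kolmogorov complexity\<close>

text \<open>Bijective base-2 numeration, least significant digit first.\<close>

fun str_code :: "bool list \<Rightarrow> nat" where
  "str_code [] = 0"
| "str_code (b # s) = 2 * str_code s + (if b then 2 else 1)"

lemma bij_str_code: "bij str_code"
proof (rule bijI)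
  show "inj str_code"
  proof (rule injI)
    show "s = t" if "str_code s = str_code t" for s t
      using that
    proof (induction s arbitrary: t)
      case Nil
      then show ?case by (cases t) (auto split: if_splits)
    next
      case (Cons b s)
      then obtain c u where t: "t = c # u" by (cases t) (auto split: if_splits)
      have "2 * str_code s + (if b then 2 else 1) = 2 * str_code u + (if c then 2 else 1)"
        using Cons.prems t by simp
      then have "b = c \<and> str_code s = str_code u"
        by (cases b; cases c; simp; presburger)
      then show ?case using Cons.IH t by simp
    qed
  qed
  have "\<exists>s. str_code s = n" for n
  proof (induction n rule: less_induct)
    case (less n)
    show ?case
    proof (cases "n = 0")
      case True
      then show ?thesis by (metis str_code.simps(1))
    next
      case False
      then have "(n - 1) div 2 < n" by linarith
      then obtain s where s: "str_code s = (n - 1) div 2"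
        using less.IH by blast
      show ?thesis
        by (rule exI[of _ "even n # s"]) (use False s in \<open>auto; presburger\<close>)
    qed
  qed
  then show "surj str_code" by (metis surjI)
qed

text \<open>Universality is additive optimality, so every machine universal by simulation qualifies.\<close>

definition universal_machine :: "(bool list \<rightharpoonup> bool list) \<Rightarrow> bool" where
  "universal_machine U \<longleftrightarrow>
     partial_recursive str_code str_code U \<and>
     (\<forall>V. partial_recursive str_code str_code V \<longrightarrow>
        (\<exists>c. \<forall>p x. V p = Some x \<longrightarrow> (\<exists>q. U q = Some x \<and> length q \<le> length p + c)))"

text \<open>A universal machine outputs every string, so the minimum below is over a nonempty set.\<close>

definition plain_C :: "(bool list \<rightharpoonup> bool list) \<Rightarrow> bool list \<Rightarrow> nat" where
  "plain_C U x = (LEAST n. \<exists>p. U p = Some x \<and> length p = n)"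

definition recursive_upper_bound ::
    "(bool list \<rightharpoonup> bool list) \<Rightarrow> (bool list \<Rightarrow> nat) \<Rightarrow> bool" where
  "recursive_upper_bound U D \<longleftrightarrow> recursive str_code id D \<and> (\<forall>x. plain_C U x \<le> D x)"


section \<open>Degrees\<close>

definition dominates :: "('a \<Rightarrow> nat) \<Rightarrow> ('a \<Rightarrow> nat) \<Rightarrow> bool" where
  "dominates u v \<longleftrightarrow> (\<forall>\<^sub>\<infinity>x. u x \<ge> v x)"

definition high :: "nat set \<Rightarrow> bool" where
  "high A \<longleftrightarrow>
     (\<exists>f :: nat \<Rightarrow> nat. computes A id id f \<and>
        (\<forall>h :: nat \<Rightarrow> nat. recursive id id h \<longrightarrow> dominates f h))"

definition DNR :: "(nat \<Rightarrow> nat \<rightharpoonup> nat) \<Rightarrow> (nat \<Rightarrow> nat) \<Rightarrow> bool" where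
  "DNR \<phi> f \<longleftrightarrow> (\<forall>x y. \<phi> x x = Some y \<longrightarrow> f x \<noteq> y)"

definition PA_complete :: "(nat \<Rightarrow> nat \<rightharpoonup> nat) \<Rightarrow> nat set \<Rightarrow> bool" where
  "PA_complete \<phi> A \<longleftrightarrow>
     (\<exists>g :: nat \<Rightarrow> nat. computes A id id g \<and> range g \<subseteq> {0, 1} \<and> DNR \<phi> g)"

end

theory Submission
  imports Defs "HOL-Library.Infinite_Set"
begin

text \<open>
  The cycle is (1) to (2) to (3) to (1), with (4) tied to (1) directly.

  High degrees: a function dominating all recursive functions bounds the search for a short
  program, respectively for the value of the diagonal function, well enough to beat every
  recursive bound almost everywhere.

  PA-complete degrees: for each \<open>n\<close> a superset \<open>S\<close> of \<open>W = {U p | length p = n}\<close> with at most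
  \<open>2 ^ n\<close> elements is decided string by string. As long as the part of \<open>S\<close> chosen so far together
  with \<open>W\<close> has at most \<open>2 ^ n\<close> elements, at most one of the events "x is enumerated into W" and
  "adding x would make this union too large" occurs, and a 0-1-valued DNR function avoids the
  corresponding wrong decision. Then \<open>B x\<close> is the least \<open>n\<close> with \<open>x\<close> in \<open>S\<close>.

  Given \<open>B\<close>, counting yields a string \<open>F n\<close> of length \<open>n\<close> with \<open>B (F n) \<ge> n\<close>.

  Given \<open>F\<close>, a machine maps a program of length \<open>prod_encode (e, k)\<close> to the same string extended by
  \<open>k\<close> bits coding \<open>\<phi> e e\<close>. If \<open>k\<close> exceeds the overhead of this machine, the output has complexity
  below its length, so the last \<open>k\<close> bits of \<open>F (prod_encode (e, k) + k)\<close> yield a function \<open>h\<close> with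
  values below \<open>2 ^ k\<close> that differs from the diagonal almost everywhere on each recursive part of
  its domain. If \<open>h\<close> nevertheless agrees with the diagonal infinitely often, then the stage at which
  an agreement beyond \<open>n\<close> shows up dominates every recursive function, so \<open>A\<close> is high; otherwise a
  finite modification of \<open>h\<close> is DNR, and Jockusch's argument turns a bounded DNR function into a
  0-1-valued one.
\<close>

section \<open>Total functions recursive in an oracle\<close>

definition pfst :: "nat \<Rightarrow> nat" where "pfst p = fst (prod_decode p)"
definition psnd :: "nat \<Rightarrow> nat" where "psnd p = snd (prod_decode p)"

lemma pfst_encode [simp]: "pfst (prod_encode (a, b)) = a"
  and psnd_encode [simp]: "psnd (prod_encode (a, b)) = b"
  by (simp_all add: pfst_def psnd_def)

definition recf :: "nat set \<Rightarrow> (nat \<Rightarrow> nat) \<Rightarrow> bool" where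
  "recf A f \<longleftrightarrow> partrec_in A (\<lambda>x. Some (f x))"

definition dec :: "nat set \<Rightarrow> (nat \<Rightarrow> bool) \<Rightarrow> bool" where
  "dec A P \<longleftrightarrow> recf A (\<lambda>x. of_bool (P x))"

abbreviation recf2 :: "nat set \<Rightarrow> (nat \<Rightarrow> nat \<Rightarrow> nat) \<Rightarrow> bool" where
  "recf2 A T \<equiv> recf A (\<lambda>p. T (pfst p) (psnd p))"

abbreviation dec2 :: "nat set \<Rightarrow> (nat \<Rightarrow> nat \<Rightarrow> bool) \<Rightarrow> bool" where
  "dec2 A P \<equiv> dec A (\<lambda>p. P (pfst p) (psnd p))"

text \<open>The oracle enters only through its characteristic function, which for the empty oracle
  is the constant 0.\<close>

lemma partrec_in_mono_empty:
  assumes "partrec_in {} f"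
  shows "partrec_in A f"
  using assms
proof induction
  case char_fun
  then show ?case using partrec_in.zero by simp
qed (rule partrec_in.intros; assumption)+

lemma recf_mono_empty: "recf {} f \<Longrightarrow> recf A f"
  unfolding recf_def by (rule partrec_in_mono_empty)

lemma partrec_comp_total: "partrec_in A f \<Longrightarrow> recf A g \<Longrightarrow> partrec_in A (\<lambda>x. f (g x))"
  unfolding recf_def using partrec_in.comp[of A f "\<lambda>x. Some (g x)"] by simp

lemma recf_app: "recf A h \<Longrightarrow> recf A f \<Longrightarrow> recf A (\<lambda>x. h (f x))"
  unfolding recf_def[of A h] recf_def[of A "\<lambda>x. h (f x)"] by (rule partrec_comp_total)

lemma recf_pair: "recf A f \<Longrightarrow> recf A g \<Longrightarrow> recf A (\<lambda>x. prod_encode (f x, g x))"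
  unfolding recf_def using partrec_in.pair[of A "\<lambda>x. Some (f x)" "\<lambda>x. Some (g x)"] by simp

lemma recf_pfst: "recf A f \<Longrightarrow> recf A (\<lambda>x. pfst (f x))"
  and recf_psnd: "recf A f \<Longrightarrow> recf A (\<lambda>x. psnd (f x))"
  using recf_app[of A pfst f] recf_app[of A psnd f] partrec_in.left[of A] partrec_in.right[of A]
  by (simp_all add: recf_def pfst_def psnd_def)

lemma recf_Suc: "recf A f \<Longrightarrow> recf A (\<lambda>x. Suc (f x))"
  using recf_app[of A Suc f] partrec_in.succ[of A] by (simp add: recf_def)

lemma recf_id: "recf A (\<lambda>x. x)"
  using partrec_in.pair[OF partrec_in.left[of A] partrec_in.right[of A]]
  by (simp add: recf_def)

lemma recf_const: "recf A (\<lambda>_. c)"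
proof (induction c)
  case 0
  show ?case using partrec_in.zero by (simp add: recf_def)
next
  case (Suc c)
  then show ?case by (rule recf_Suc)
qed

lemma recf2_app:
  assumes "recf2 A T" "recf A f" "recf A g"
  shows "recf A (\<lambda>x. T (f x) (g x))"
  using recf_app[OF assms(1) recf_pair[OF assms(2,3)]] by simp

lemma dec_app: "dec A P \<Longrightarrow> recf A f \<Longrightarrow> dec A (\<lambda>x. P (f x))"
  unfolding dec_def using recf_app[of A "\<lambda>x. of_bool (P x)" f] by simp

lemma dec2_app:
  assumes "dec2 A P" "recf A f" "recf A g"
  shows "dec A (\<lambda>x. P (f x) (g x))"
  using dec_app[OF assms(1) recf_pair[OF assms(2,3)]] by simp

text \<open>For total base and step every bind in the recursion scheme succeeds. The scheme takes
  parameter and depth as one pair, so it is finally composed with the pair of \<open>x\<close> and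
  \<open>k x\<close>.\<close>

lemma recf_rec_nat:
  assumes f: "recf A f"
    and g: "recf A (\<lambda>p. g (pfst p) (pfst (psnd p)) (psnd (psnd p)))"
    and k: "recf A k"
  shows "recf A (\<lambda>x. rec_nat (f x) (g x) (k x))"
proof -
  let ?g = "\<lambda>p. Some (g (pfst p) (pfst (psnd p)) (psnd (psnd p)))"
  have "partrec_in A (\<lambda>n. case prod_decode n of (a, k) \<Rightarrow>
      rec_nat (Some (f a))
        (\<lambda>i r. Option.bind r (\<lambda>v. ?g (prod_encode (a, prod_encode (i, v))))) k)"
    using partrec_in.prim_rec[of A "\<lambda>x. Some (f x)" ?g] f g by (simp add: recf_def)
  moreover have "rec_nat (Some (f a))
        (\<lambda>i r. Option.bind r (\<lambda>v. ?g (prod_encode (a, prod_encode (i, v))))) k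
      = Some (rec_nat (f a) (g a) k)" for a k
    by (induction k) simp_all
  ultimately have "recf A (\<lambda>n. rec_nat (f (pfst n)) (g (pfst n)) (psnd n))"
    by (simp add: recf_def pfst_def psnd_def case_prod_beta)
  from recf_app[OF this recf_pair[OF recf_id k]] show ?thesis by simp
qed

section \<open>Arithmetic by primitive recursion\<close>

lemma recf_pred: "recf A f \<Longrightarrow> recf A (\<lambda>x. f x - 1)"
proof -
  have "rec_nat 0 (\<lambda>i v. i) k = k - 1" for k :: nat by (cases k) auto
  then show "recf A f \<Longrightarrow> ?thesis"
    using recf_rec_nat[of A "\<lambda>_. 0" "\<lambda>_ i v. i" f]
    by (simp add: recf_const recf_pfst recf_psnd recf_id)
qed

lemma recf_add:
  assumes "recf A f" "recf A g"
  shows "recf A (\<lambda>x. f x + g x)"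
proof -
  have "rec_nat a (\<lambda>_. Suc) k = a + k" for a k by (induction k) auto
  then show ?thesis
    using recf_rec_nat[of A f "\<lambda>_ _ v. Suc v" g] assms
    by (simp add: recf_Suc recf_psnd recf_id)
qed

lemma recf_diff:
  assumes "recf A f" "recf A g"
  shows "recf A (\<lambda>x. f x - g x)"
proof -
  have "rec_nat a (\<lambda>_ v. v - 1) k = a - k" for a k :: nat by (induction k) auto
  then show ?thesis
    using recf_rec_nat[of A f "\<lambda>_ _ v. v - 1" g, OF assms(1) _ assms(2)]
    by (simp only: recf_pred recf_psnd recf_id)
qed

lemma recf_mult:
  assumes "recf A f" "recf A g"
  shows "recf A (\<lambda>x. f x * g x)"
proof -
  have "rec_nat 0 (\<lambda>_ v. v + a) k = a * k" for a k :: nat by (induction k) auto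
  then show ?thesis
    using recf_rec_nat[of A "\<lambda>_. 0" "\<lambda>x _ v. v + f x" g, OF recf_const _ assms(2)]
      recf_app[OF assms(1) recf_pfst[OF recf_id]]
    by (simp only: recf_add recf_psnd recf_id)
qed

lemma recf_power:
  assumes "recf A f" "recf A g"
  shows "recf A (\<lambda>x. f x ^ g x)"
proof -
  have "rec_nat 1 (\<lambda>_ v. a * v) k = a ^ k" for a k :: nat by (induction k) auto
  then show ?thesis
    using recf_rec_nat[of A "\<lambda>_. 1" "\<lambda>x _ v. f x * v" g, OF recf_const _ assms(2)]
      recf_app[OF assms(1) recf_pfst[OF recf_id]]
    by (simp only: recf_mult recf_psnd recf_id)
qed

section \<open>Decidable predicates, definition by cases, bounded quantifiers and sums\<close>

lemma dec_not:
  assumes "dec A P"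
  shows "dec A (\<lambda>x. \<not> P x)"
proof -
  have "(\<lambda>x. of_bool (\<not> P x)) = (\<lambda>x. 1 - of_bool (P x) :: nat)" by auto
  then show ?thesis using recf_diff[OF recf_const[of _ 1], of A "\<lambda>x. of_bool (P x)"] assms
    unfolding dec_def by simp
qed

lemma dec_conj:
  assumes "dec A P" "dec A Q"
  shows "dec A (\<lambda>x. P x \<and> Q x)"
  using recf_mult[of A "\<lambda>x. of_bool (P x)" "\<lambda>x. of_bool (Q x)"] assms
  unfolding dec_def by (simp add: of_bool_conj)

lemma dec_disj:
  assumes "dec A P" "dec A Q"
  shows "dec A (\<lambda>x. P x \<or> Q x)"
  using dec_not[OF dec_conj[OF dec_not[OF assms(1)] dec_not[OF assms(2)]]] by simp

lemma dec_le:
  assumes "recf A f" "recf A g"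
  shows "dec A (\<lambda>x. f x \<le> g x)"
proof -
  have "of_bool (f x \<le> g x) = 1 - (f x - g x)" for x by auto
  then show ?thesis unfolding dec_def using assms by (simp add: recf_diff recf_const)
qed

lemma dec_less: "recf A f \<Longrightarrow> recf A g \<Longrightarrow> dec A (\<lambda>x. f x < g x)"
  using dec_le[OF recf_Suc[of A f], of g] by (simp add: Suc_le_eq)

lemma dec_eq: "recf A f \<Longrightarrow> recf A g \<Longrightarrow> dec A (\<lambda>x. f x = g x)"
  using dec_conj[OF dec_le[of A f g] dec_le[of A g f]] by (simp add: eq_iff)

lemma recf_if:
  assumes "dec A P" "recf A f" "recf A g"
  shows "recf A (\<lambda>x. if P x then f x else g x)"
proof -
  have "(\<lambda>x. if P x then f x else g x) =
      (\<lambda>x. of_bool (P x) * f x + (1 - of_bool (P x)) * g x)" by auto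
  then show ?thesis using assms unfolding dec_def
    by (simp only: recf_add recf_mult recf_diff recf_const)
qed

lemma dec_ex_less:
  assumes P: "dec2 A P" and k: "recf A k"
  shows "dec A (\<lambda>x. \<exists>i<k x. P x i)"
proof -
  have "rec_nat 0 (\<lambda>i v. if P x i then Suc 0 else v) k = of_bool (\<exists>i<k. P x i)" for x k
    by (induction k) (auto simp: less_Suc_eq)
  then show ?thesis
    unfolding dec_def
    using recf_rec_nat[of A "\<lambda>_. 0" "\<lambda>x i v. if P x i then Suc 0 else v" k, OF recf_const _ k]
      recf_if[OF dec2_app[OF P recf_pfst[OF recf_id] recf_pfst[OF recf_psnd[OF recf_id]]]
        recf_const[of _ "Suc 0"] recf_psnd[OF recf_psnd[OF recf_id]]]
    by simp
qed

lemma recf_sum: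
  assumes f: "recf2 A f" and k: "recf A k"
  shows "recf A (\<lambda>x. \<Sum>i<k x. f x i)"
proof -
  have "rec_nat 0 (\<lambda>i v. v + f x i) k = (\<Sum>i<k. f x i)" for x k
    by (induction k) auto
  then show ?thesis
    using recf_rec_nat[of A "\<lambda>_. 0" "\<lambda>x i v. v + f x i" k, OF recf_const _ k]
      recf_add[OF recf_psnd[OF recf_psnd[OF recf_id]]
        recf2_app[OF f recf_pfst[OF recf_id] recf_pfst[OF recf_psnd[OF recf_id]]]]
    by simp
qed

section \<open>Unbounded search, division and finite modification\<close>

lemma minimize_of_bool:
  "minimize (\<lambda>n. Some (of_bool (\<not> P n))) = (if \<exists>n. P n then Some (LEAST n. P n) else None)"
  by (auto simp: minimize_def)

lemma partrec_Least:
  assumes "dec2 A P"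
  shows "partrec_in A (\<lambda>x. if \<exists>n. P x n then Some (LEAST n. P x n) else None)"
  using partrec_in.mu[OF dec_not[OF assms, unfolded dec_def recf_def]]
  by (simp add: minimize_of_bool)

lemma recf_Least:
  assumes "dec2 A P" and "\<And>x. \<exists>n. P x n"
  shows "recf A (\<lambda>x. LEAST n. P x n)"
  using partrec_Least[OF assms(1)] assms(2) by (simp add: recf_def)

lemmas rec_basic = recf_const recf_id recf_pair recf_pfst recf_psnd recf_Suc recf_add recf_diff
  recf_mult recf_power dec_not dec_conj dec_disj dec_le dec_less dec_eq recf_if

lemma recf_div:
  assumes "recf A f" "recf A g"
  shows "recf A (\<lambda>x. f x div g x)"
proof -
  \<comment> \<open>The quotient is found by search; the disjunct \<open>n = 0\<close> lets the
    search stop at once, in accordance with \<open>m div 0 = 0\<close>.\<close>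
  have least: "(LEAST q. n = 0 \<or> m < Suc q * n) = m div n" for m n :: nat
  proof (cases "n = 0")
    case False
    show ?thesis
    proof (rule Least_equality)
      show "n = 0 \<or> m < Suc (m div n) * n"
        using False dividend_less_div_times[of n m] by simp
      show "m div n \<le> q" if "n = 0 \<or> m < Suc q * n" for q
        using that False by (simp add: less_Suc_eq_le[symmetric] div_less_iff_less_mult)
    qed
  qed simp
  have "dec2 A (\<lambda>p q. psnd p = 0 \<or> pfst p < Suc q * psnd p)"
    by (intro rec_basic)
  moreover have "\<exists>q. n = 0 \<or> m < Suc q * n" for m n :: nat
    using dividend_less_div_times[of n m] by (cases "n = 0") auto
  ultimately have "recf A (\<lambda>p. LEAST q. psnd p = 0 \<or> pfst p < Suc q * psnd p)"
    by (rule recf_Least)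
  then have "recf2 A (div)" by (simp only: least)
  then show ?thesis using assms by (rule recf2_app)
qed

lemma recf_mod:
  assumes "recf A f" "recf A g"
  shows "recf A (\<lambda>x. f x mod g x)"
  using recf_diff[OF assms(1) recf_mult[OF recf_div[OF assms] assms(2)]]
  by (simp add: minus_div_mult_eq_mod)

lemma recf_of_bool: "dec A P \<Longrightarrow> recf A (\<lambda>x. of_bool (P x))"
  by (simp add: dec_def)

lemmas rec_intros = rec_basic recf_div recf_mod dec_ex_less recf_sum recf_of_bool

lemma recf_finite_modification:
  assumes "recf A f" "finite {x. f x \<noteq> g x}"
  shows "recf A g"
proof -
  have "finite S \<Longrightarrow> recf A (\<lambda>x. if x \<in> S then g x else f x)" for S
  proof (induction S rule: finite_induct)
    case empty
    then show ?case using assms(1) by simp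
  next
    case (insert y S)
    have "(\<lambda>x. if x \<in> insert y S then g x else f x) =
        (\<lambda>x. if x = y then g y else if x \<in> S then g x else f x)" by auto
    then show ?case using insert by (simp only: rec_intros)
  qed
  from this[OF assms(2)] show ?thesis by (rule back_subst[of "recf A"]) auto
qed

section \<open>Stage approximations of partial recursive functions\<close>

text \<open>\<open>T x s = 0\<close> stands for a computation that has not halted by stage
  \<open>s\<close>, and \<open>T x s = Suc y\<close> for one that has halted with value
  \<open>y\<close>.\<close>

definition stage :: "(nat \<Rightarrow> nat \<Rightarrow> nat) \<Rightarrow> (nat \<rightharpoonup> nat) \<Rightarrow> bool" where
  "stage T f \<longleftrightarrow>
     (\<forall>x s s' y. T x s = Suc y \<longrightarrow> s \<le> s' \<longrightarrow> T x s' = Suc y) \<and>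
     (\<forall>x y. f x = Some y \<longleftrightarrow> (\<exists>s. T x s = Suc y))"

lemma stage_mono: "stage T f \<Longrightarrow> T x s = Suc y \<Longrightarrow> s \<le> s' \<Longrightarrow> T x s' = Suc y"
  unfolding stage_def by blast

lemma stage_max:
  assumes "stage T f" "T x s = Suc y"
  shows "T x (max s s') = Suc y" and "T x (max s' s) = Suc y"
  using stage_mono[OF assms] by simp_all

lemma stage_Some_iff: "stage T f \<Longrightarrow> f x = Some y \<longleftrightarrow> (\<exists>s. T x s = Suc y)"
  unfolding stage_def by blast

lemma stage_total: "stage (\<lambda>x _. Suc (f x)) (\<lambda>x. Some (f x))"
  by (auto simp: stage_def)

lemma stageI:
  assumes "\<And>x s s' y. T x s = Suc y \<Longrightarrow> s \<le> s' \<Longrightarrow> T x s' = Suc y"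
    and "\<And>x s y. T x s = Suc y \<Longrightarrow> f x = Some y"
    and "\<And>x y. f x = Some y \<Longrightarrow> \<exists>s. T x s = Suc y"
  shows "stage T f"
  unfolding stage_def using assms by blast

text \<open>Minimality turns definedness at the earlier arguments into a positive value there, which
  is the form that a stage can confirm.\<close>

lemma minimize_eq_Some_iff:
  "minimize h = Some n \<longleftrightarrow> h n = Some 0 \<and> (\<forall>m<n. \<exists>v. h m = Some (Suc v))"
proof -
  have *: "(LEAST k. h k = Some 0) = n"
    if "h n = Some 0" "\<forall>m<n. \<exists>v. h m = Some (Suc v)" for n
    using that by (intro Least_equality) (auto simp: not_less[symmetric])
  show ?thesis
  proof
    assume min: "minimize h = Some n"
    then obtain k where k: "h k = Some 0" "\<forall>m<k. h m \<noteq> None" and n: "n = (LEAST k. h k = Some 0)"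
      by (auto simp: minimize_def split: if_splits)
    have "h n = Some 0" "n \<le> k" unfolding n using k(1) by (rule LeastI, rule Least_le)
    moreover have "\<exists>v. h m = Some (Suc v)" if "m < n" for m
      using not_less_Least[of m "\<lambda>k. h k = Some 0"] that k(2) \<open>n \<le> k\<close> unfolding n
      by (cases "h m"; cases "the (h m)") (auto simp: n)
    ultimately show "h n = Some 0 \<and> (\<forall>m<n. \<exists>v. h m = Some (Suc v))" by blast
  next
    assume "h n = Some 0 \<and> (\<forall>m<n. \<exists>v. h m = Some (Suc v))"
    moreover from this have "\<forall>m<n. h m \<noteq> None" by auto
    ultimately show "minimize h = Some n" using *[of n] unfolding minimize_def by auto
  qed
qed

text \<open>By monotonicity the maximum of finitely many halting stages works. The lower bound
  \<open>b\<close> serves the bounded search in \<open>stage_mu\<close>.\<close>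

lemma stage_common:
  assumes T: "stage T f" and "\<forall>m<n::nat. f (e m) = Some (v m)"
  shows "\<exists>s\<ge>b. \<forall>m<n::nat. T (e m) s = Suc (v m)"
  using assms(2)
proof (induction n)
  case (Suc n)
  then obtain s where s: "s \<ge> b" "\<forall>m<n. T (e m) s = Suc (v m)" by auto
  have "f (e n) = Some (v n)" using Suc.prems by simp
  then obtain s' where s': "T (e n) s' = Suc (v n)"
    using stage_Some_iff[OF T] by blast
  have "T (e m) (max s s') = Suc (v m)" if "m < Suc n" for m
  proof (cases "m = n")
    case True
    then show ?thesis using stage_mono[OF T s'] by simp
  next
    case False
    then show ?thesis using that s(2) stage_mono[OF T, of "e m" s "v m"] by simp
  qed
  then show ?case using s(1) by (intro exI[of _ "max s s'"]) auto
qed auto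

section \<open>Stages along the closure operations\<close>

lemma stage_pair:
  assumes "stage F f" "stage G g"
  shows "stage (\<lambda>x s. if F x s = 0 \<or> G x s = 0 then 0
      else Suc (prod_encode (F x s - 1, G x s - 1)))
    (\<lambda>n. Option.bind (f n) (\<lambda>a. Option.bind (g n) (\<lambda>b. Some (prod_encode (a, b)))))"
    (is "stage ?T ?h")
proof (rule stageI)
  have iff: "?T x s = Suc y \<longleftrightarrow>
      (\<exists>a b. F x s = Suc a \<and> G x s = Suc b \<and> y = prod_encode (a, b))" for x s y
    by (cases "F x s"; cases "G x s") auto
  show "?T x s' = Suc y" if "?T x s = Suc y" "s \<le> s'" for x s s' y
    using that stage_mono[OF assms(1)] stage_mono[OF assms(2)] unfolding iff by blast
  show "?h x = Some y" if "?T x s = Suc y" for x s y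
    using that stage_Some_iff[OF assms(1)] stage_Some_iff[OF assms(2)] unfolding iff by force
  show "\<exists>s. ?T x s = Suc y" if "?h x = Some y" for x y
  proof -
    from that obtain a b where ab: "f x = Some a" "g x = Some b" "y = prod_encode (a, b)"
      by (auto simp: bind_eq_Some_conv)
    then obtain s s' where "F x s = Suc a" "G x s' = Suc b"
      using stage_Some_iff[OF assms(1)] stage_Some_iff[OF assms(2)] by blast
    then have "F x (max s s') = Suc a" "G x (max s s') = Suc b"
      using stage_max[OF assms(1)] stage_max[OF assms(2)] by blast+
    with ab show ?thesis unfolding iff by blast
  qed
qed

lemma stage_comp:
  assumes "stage F f" "stage G g"
  shows "stage (\<lambda>x s. if G x s = 0 then 0 else F (G x s - 1) s) (\<lambda>n. Option.bind (g n) f)"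
    (is "stage ?T ?h")
proof (rule stageI)
  have iff: "?T x s = Suc y \<longleftrightarrow> (\<exists>a. G x s = Suc a \<and> F a s = Suc y)" for x s y
    by (cases "G x s") auto
  show "?T x s' = Suc y" if "?T x s = Suc y" "s \<le> s'" for x s s' y
    using that stage_mono[OF assms(1)] stage_mono[OF assms(2)] unfolding iff by blast
  show "?h x = Some y" if "?T x s = Suc y" for x s y
    using that stage_Some_iff[OF assms(1)] stage_Some_iff[OF assms(2)] unfolding iff by force
  show "\<exists>s. ?T x s = Suc y" if "?h x = Some y" for x y
  proof -
    from that obtain a where ab: "g x = Some a" "f a = Some y"
      by (auto simp: bind_eq_Some_conv)
    then obtain s s' where "G x s = Suc a" "F a s' = Suc y"
      using stage_Some_iff[OF assms(1)] stage_Some_iff[OF assms(2)] by blast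
    then have "G x (max s s') = Suc a" "F a (max s s') = Suc y"
      using stage_max[OF assms(1)] stage_max[OF assms(2)] by blast+
    then show ?thesis unfolding iff by blast
  qed
qed

text \<open>All steps of the recursion share one stage bound; completeness takes the maximum of the
  stages needed for the previous value and for the step.\<close>

lemma stage_prim_rec:
  assumes "stage F f" "stage G g"
  shows "stage (\<lambda>n s. rec_nat (F (pfst n) s)
      (\<lambda>i r. if r = 0 then 0 else G (prod_encode (pfst n, prod_encode (i, r - 1))) s) (psnd n))
    (\<lambda>n. case prod_decode n of (a, k) \<Rightarrow>
      rec_nat (f a)
        (\<lambda>i r. Option.bind r (\<lambda>v. g (prod_encode (a, prod_encode (i, v))))) k)"
proof -
  define R where "R a k s = rec_nat (F a s)
      (\<lambda>i r. if r = 0 then 0 else G (prod_encode (a, prod_encode (i, r - 1))) s) k" for a k s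
  define h where "h a k = rec_nat (f a)
        (\<lambda>i r. Option.bind r (\<lambda>v. g (prod_encode (a, prod_encode (i, v))))) k" for a k
  have R0: "R a 0 s = F a s" for a s by (simp add: R_def)
  have RS: "R a (Suc k) s = Suc y \<longleftrightarrow>
      (\<exists>v. R a k s = Suc v \<and> G (prod_encode (a, prod_encode (k, v))) s = Suc y)" for a k s y
    by (cases "R a k s") (auto simp: R_def)
  have h0: "h a 0 = f a" for a by (simp add: h_def)
  have hS: "h a (Suc k) = Option.bind (h a k) (\<lambda>v. g (prod_encode (a, prod_encode (k, v))))"
    for a k by (simp add: h_def)
  have mono: "R a k s = Suc y \<Longrightarrow> s \<le> s' \<Longrightarrow> R a k s' = Suc y" for a k s s' y
  proof (induction k arbitrary: y)
    case 0
    then show ?case using stage_mono[OF assms(1)] unfolding R0 by blast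
  next
    case (Suc k)
    then show ?case using stage_mono[OF assms(2)] unfolding RS by blast
  qed
  have sound: "R a k s = Suc y \<Longrightarrow> h a k = Some y" for a k s y
  proof (induction k arbitrary: y)
    case 0
    then show ?case using stage_Some_iff[OF assms(1)] unfolding R0 h0 by blast
  next
    case (Suc k)
    then show ?case using stage_Some_iff[OF assms(2)] unfolding RS hS bind_eq_Some_conv by blast
  qed
  have complete: "h a k = Some y \<Longrightarrow> \<exists>s. R a k s = Suc y" for a k y
  proof (induction k arbitrary: y)
    case 0
    then show ?case using stage_Some_iff[OF assms(1)] unfolding R0 h0 by blast
  next
    case (Suc k)
    then obtain v where v: "h a k = Some v" "g (prod_encode (a, prod_encode (k, v))) = Some y"
      unfolding hS bind_eq_Some_conv by blast
    then obtain s s' where "R a k s = Suc v" "G (prod_encode (a, prod_encode (k, v))) s' = Suc y"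
      using Suc.IH stage_Some_iff[OF assms(2)] by blast
    then have "R a k (max s s') = Suc v"
        "G (prod_encode (a, prod_encode (k, v))) (max s s') = Suc y"
      using mono[OF _ max.cobounded1] stage_max[OF assms(2)] by blast+
    then show ?case unfolding RS by blast
  qed
  have "stage (\<lambda>n s. R (pfst n) (psnd n) s) (\<lambda>n. h (pfst n) (psnd n))"
    using mono sound complete by (intro stageI) blast+
  then show ?thesis unfolding R_def h_def pfst_def psnd_def case_prod_beta .
qed

text \<open>\<open>N a s\<close> is the first argument below \<open>s\<close> at which, by stage
  \<open>s\<close>, the computation has either not halted (\<open>F\<close> is 0) or halted with
  value 0 (\<open>F\<close> is 1), and \<open>s\<close> if there is none. A value is returned only
  if \<open>F\<close> is 1 there.\<close>

lemma stage_mu: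
  assumes F: "stage F f"
  defines "N \<equiv> \<lambda>a s. LEAST n. n = s \<or> F (prod_encode (a, n)) s \<le> 1"
  shows "stage (\<lambda>a s. if F (prod_encode (a, N a s)) s = Suc 0 then Suc (N a s) else 0)
    (\<lambda>a. minimize (\<lambda>n. f (prod_encode (a, n))))" (is "stage ?T ?h")
proof (rule stageI)
  have iff: "?T a s = Suc n \<longleftrightarrow> n \<le> s \<and> F (prod_encode (a, n)) s = Suc 0 \<and>
      (\<forall>m<n. \<exists>v. F (prod_encode (a, m)) s = Suc (Suc v))" for a s n
  proof
    assume asm: "?T a s = Suc n"
    then have n: "n = N a s" and "F (prod_encode (a, n)) s = Suc 0" by (auto split: if_splits)
    moreover have "n \<le> s" unfolding n N_def by (rule Least_le) simp
    moreover have "\<exists>v. F (prod_encode (a, m)) s = Suc (Suc v)" if "m < n" for m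
    proof -
      have "\<not> F (prod_encode (a, m)) s \<le> 1"
        using that not_less_Least[of m "\<lambda>n. n = s \<or> F (prod_encode (a, n)) s \<le> 1"]
        unfolding n N_def by blast
      then show ?thesis by presburger
    qed
    ultimately show "n \<le> s \<and> F (prod_encode (a, n)) s = Suc 0 \<and>
      (\<forall>m<n. \<exists>v. F (prod_encode (a, m)) s = Suc (Suc v))" by blast
  next
    assume asm: "n \<le> s \<and> F (prod_encode (a, n)) s = Suc 0 \<and>
      (\<forall>m<n. \<exists>v. F (prod_encode (a, m)) s = Suc (Suc v))"
    have "N a s = n" unfolding N_def
    proof (rule Least_equality)
      show "n \<le> m" if "m = s \<or> F (prod_encode (a, m)) s \<le> 1" for m
        using that asm by (force simp: not_less[symmetric])
    qed (use asm in simp)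
    then show "?T a s = Suc n" using asm by simp
  qed
  show "?T x s' = Suc y" if "?T x s = Suc y" "s \<le> s'" for x s s' y
    using that stage_mono[OF F] unfolding iff by (meson le_trans)
  show "?h x = Some y" if "?T x s = Suc y" for x s y
    using that stage_Some_iff[OF F] unfolding iff minimize_eq_Some_iff by blast
  show "\<exists>s. ?T x s = Suc y" if "?h x = Some y" for x y
  proof -
    define v where "v m = the (f (prod_encode (x, m)))" for m
    have v: "\<forall>m<Suc y. f (prod_encode (x, m)) = Some (v m)"
      using that unfolding minimize_eq_Some_iff v_def by (auto simp: less_Suc_eq)
    obtain s where s: "s \<ge> y" "\<forall>m<Suc y. F (prod_encode (x, m)) s = Suc (v m)"
      using stage_common[OF F, of "Suc y" "\<lambda>m. prod_encode (x, m)" v y] v by blast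
    have "v y = 0" "\<forall>m<y. \<exists>w. v m = Suc w"
      using that v unfolding minimize_eq_Some_iff by (auto simp: less_Suc_eq)
    then have "?T x s = Suc y" unfolding iff using s by fastforce
    then show ?thesis ..
  qed
qed

text \<open>Induction on the generation of \<open>f\<close>. The result plays the part of Kleene's T
  predicate: halting within a given number of stages becomes decidable.\<close>

lemma stage_exists:
  assumes "partrec_in {} f"
  shows "\<exists>T. recf2 {} T \<and> stage T f"
  using assms
proof induction
  case zero
  show ?case by (intro exI conjI, rule_tac[2] stage_total) (intro rec_intros)
next
  case succ
  show ?case by (intro exI conjI, rule_tac[2] stage_total) (intro rec_intros)
next
  case left
  show ?case unfolding pfst_def[symmetric]
    by (intro exI conjI, rule_tac[2] stage_total) (intro rec_intros)
next
  case right
  show ?case unfolding psnd_def[symmetric]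
    by (intro exI conjI, rule_tac[2] stage_total) (intro rec_intros)
next
  case char_fun
  show ?case by (intro exI conjI, rule_tac[2] stage_total) (simp add: rec_intros)
next
  case (pair f g)
  then obtain F G where F: "recf2 {} F" "stage F f" and G: "recf2 {} G" "stage G g" by blast
  show ?case
    by (intro exI conjI, rule_tac[2] stage_pair[OF F(2) G(2)])
      (intro rec_intros F(1) G(1))
next
  case (comp f g)
  then obtain F G where F: "recf2 {} F" "stage F f" and G: "recf2 {} G" "stage G g" by blast
  show ?case
    by (intro exI conjI, rule_tac[2] stage_comp[OF F(2) G(2)])
      (intro rec_intros recf2_app[OF F(1)] recf2_app[OF G(1)])
next
  case (prim_rec f g)
  then obtain F G where F: "recf2 {} F" "stage F f" and G: "recf2 {} G" "stage G g" by blast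
  show ?case
    by (intro exI conjI, rule_tac[2] stage_prim_rec[OF F(2) G(2)])
      (intro rec_intros recf_rec_nat recf2_app[OF F(1)] recf2_app[OF G(1)])
next
  case (mu f)
  then obtain F where F: "recf2 {} F" "stage F f" by blast
  have "recf {} (\<lambda>p. LEAST n. n = psnd p \<or> F (prod_encode (pfst p, n)) (psnd p) \<le> 1)"
    by (rule recf_Least) (intro rec_intros recf2_app[OF F(1)], blast)
  then have "recf2 {} (\<lambda>a s. LEAST n. n = s \<or> F (prod_encode (a, n)) s \<le> 1)" .
  note N = recf2_app[OF this]
  show ?case
    by (intro exI conjI, rule_tac[2] stage_mu[OF F(2)])
      (intro rec_intros recf2_app[OF F(1)] N)
qed

section \<open>Diagonal avoidance\<close>

lemma computes_id_id: "computes A id id f \<longleftrightarrow> recf A f"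
proof -
  have "(\<forall>x. g x = Some (f x)) \<longleftrightarrow> g = (\<lambda>x. Some (f x))" for g by auto
  then show ?thesis by (simp add: computes_def computes_partial_def recf_def)
qed

lemma recursive_set_iff_dec: "recursive_set R \<longleftrightarrow> dec {} (\<lambda>x. x \<in> R)"
  by (simp add: recursive_set_def computes_id_id dec_def)

lemma acceptable_diag:
  assumes "acceptable \<phi>"
  shows "partrec_in {} (\<lambda>n. \<phi> n n)"
proof -
  obtain g where "partrec_in {} g" "\<forall>e x. g (prod_encode (e, x)) = \<phi> e x"
    using assms by (auto simp: acceptable_def computes_partial_def option.map_id)
  with partrec_comp_total[of "{}" g "\<lambda>n. prod_encode (n, n)"] show ?thesis
    by (simp add: recf_pair recf_id)
qed

text \<open>Acceptability is applied to the numbering whose \<open>e\<close>-th function is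
  constantly \<open>\<psi> e\<close>. Since the argument does not matter, the diagonal at
  \<open>t e\<close> takes the value \<open>\<psi> e\<close>.\<close>

lemma acceptable_diag_surj:
  assumes "acceptable \<phi>" "partrec_in {} \<psi>"
  shows "\<exists>t. recf {} t \<and> (\<forall>z. \<phi> (t z) (t z) = \<psi> z)"
proof -
  have "partrec_in {} (\<lambda>p. \<psi> (pfst p))"
    by (rule partrec_comp_total[OF assms(2) recf_pfst[OF recf_id]])
  then have "partial_recursive prod_encode id (\<lambda>(e, x :: nat). \<psi> e)"
    unfolding computes_partial_def
    by (intro exI[of _ "\<lambda>p. \<psi> (pfst p)"]) (auto simp: option.map_id)
  then obtain t where "recursive id id t" "\<forall>e. \<phi> (t e) = (\<lambda>_. \<psi> e)"
    using assms(1) unfolding acceptable_def by (metis (no_types, lifting))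
  then show ?thesis by (auto simp: computes_id_id)
qed

text \<open>A 0-1-valued DNR function is composed with the map that locates \<open>\<psi>\<close> on
  the diagonal.\<close>

lemma PA_complete_avoids:
  assumes "acceptable \<phi>" "PA_complete \<phi> A" "partrec_in {} \<psi>"
  obtains h where "recf A h" "\<And>z. h z = 0 \<or> h z = 1" "\<And>z. \<psi> z \<noteq> Some (h z)"
proof -
  obtain g where g: "recf A g" "range g \<subseteq> {0, 1}" "DNR \<phi> g"
    using assms(2) by (auto simp: PA_complete_def computes_id_id)
  obtain t where t: "recf {} t" "\<And>z. \<phi> (t z) (t z) = \<psi> z"
    using acceptable_diag_surj[OF assms(1,3)] by blast
  show thesis
  proof
    show "recf A (\<lambda>z. g (t z))" by (rule recf_app[OF g(1) recf_mono_empty[OF t(1)]])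
    show "g (t z) = 0 \<or> g (t z) = 1" for z using g(2) by blast
    show "\<psi> z \<noteq> Some (g (t z))" for z using g(3) t(2)[of z] by (metis DNR_def)
  qed
qed

section \<open>Agreement with the diagonal and bounded DNR functions\<close>

text \<open>With infinitely many agreements, \<open>f n\<close> can be the stage at which one beyond
  \<open>n\<close> shows up. If a recursive \<open>r\<close> exceeded \<open>f\<close> infinitely
  often, the recursive set of all \<open>e\<close> with halting stage at most \<open>r i\<close> for
  some \<open>i \<le> e\<close> would contain infinitely many agreements.\<close>

lemma high_or_finite_agreement:
  assumes \<delta>: "partrec_in {} \<delta>" and h: "recf A h"
    and avoid: "\<And>R. infinite R \<Longrightarrow> recursive_set R \<Longrightarrow> R \<subseteq> {n. \<delta> n \<noteq> None} \<Longrightarrow>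
      \<forall>\<^sub>\<infinity>n. n \<in> R \<longrightarrow> h n \<noteq> the (\<delta> n)"
  shows "high A \<or> finite {n. \<delta> n = Some (h n)}"
proof (rule disjCI)
  assume inf: "infinite {n. \<delta> n = Some (h n)}"
  obtain T where T: "recf2 {} T" "stage T \<delta>" using stage_exists[OF \<delta>] by blast
  \<comment> \<open>The bound \<open>e < Suc s\<close> keeps the search for an agreement
    decidable.\<close>
  define P where "P n s \<longleftrightarrow> (\<exists>e<Suc s. n \<le> e \<and> T e s = Suc (h e))" for n s
  define f where "f n = (LEAST s. P n s)" for n
  have ex: "\<exists>s. P n s" for n
  proof -
    obtain e where e: "n \<le> e" "\<delta> e = Some (h e)"
      using inf unfolding infinite_nat_iff_unbounded_le by blast
    then obtain s where s: "T e s = Suc (h e)" using stage_Some_iff[OF T(2)] by blast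
    have "T e (max s e) = Suc (h e)" by (rule stage_max[OF T(2) s])
    then show ?thesis using e(1) unfolding P_def by (intro exI[of _ "max s e"] exI[of _ e]) auto
  qed
  have "dec2 A P"
    unfolding P_def
    by (intro rec_intros recf2_app[OF recf_mono_empty[OF T(1)]] recf_app[OF h])
  then have f: "recf A f" unfolding f_def using ex by (rule recf_Least)
  have "dominates f r" if r: "recf {} r" for r
  proof (rule ccontr)
    assume "\<not> dominates f r"
    then have often: "\<exists>n\<ge>m. f n < r n" for m
      by (simp add: dominates_def MOST_nat_le not_le)
    txt \<open>The quantifier over \<open>i\<close> replaces the assumption that \<open>r\<close> is increasing.\<close>
    define R where "R = {e. \<exists>i<Suc e. 0 < T e (r i)}"
    have R: "recursive_set R"
      unfolding recursive_set_iff_dec R_def mem_Collect_eq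
      by (intro rec_intros recf2_app[OF T(1)] recf_app[OF r])
    have dom: "R \<subseteq> {n. \<delta> n \<noteq> None}"
      using stage_Some_iff[OF T(2)] unfolding R_def by (force simp: gr0_conv_Suc)
    have agree: "\<exists>e\<ge>m. e \<in> R \<and> \<delta> e = Some (h e)" for m
    proof -
      obtain n where n: "m \<le> n" "f n < r n" using often by blast
      have "P n (f n)" unfolding f_def using ex by (rule LeastI_ex)
      then obtain e where e: "n \<le> e" "T e (f n) = Suc (h e)" unfolding P_def by blast
      have "T e (r n) = Suc (h e)" using n(2) by (intro stage_mono[OF T(2) e(2)]) simp
      then have "e \<in> R" unfolding R_def using e(1) by (auto intro!: exI[of _ n])
      moreover have "\<delta> e = Some (h e)" using stage_Some_iff[OF T(2)] e(2) by blast
      ultimately show ?thesis using e(1) n(1) by (meson le_trans)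
    qed
    then have "infinite R" unfolding infinite_nat_iff_unbounded_le by blast
    from avoid[OF this R dom] obtain m where "\<forall>n\<ge>m. n \<in> R \<longrightarrow> h n \<noteq> the (\<delta> n)"
      unfolding MOST_nat_le by blast
    with agree[of m] show False by auto
  qed
  with f show "high A" by (auto simp: high_def computes_id_id)
qed

text \<open>
  Jockusch's argument: \<open>k x y\<close> avoids the pair of diagonal values at \<open>x\<close> and \<open>y\<close>. Either its upper
  half is DNR in \<open>y\<close> for some \<open>x\<close>, or for each \<open>x\<close> a \<open>y\<close> with a wrong upper half can be found, and then
  the lower half is right.
\<close>

lemma PA_complete_if_bounded_DNR:
  assumes \<phi>: "acceptable \<phi>"
  shows "recf A h \<Longrightarrow> DNR \<phi> h \<Longrightarrow> (\<And>x. h x < 2 ^ m) \<Longrightarrow> PA_complete \<phi> A"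
proof (induction m arbitrary: h)
  case 0
  then have "range h \<subseteq> {0, 1}" by auto
  with 0 show ?case by (auto simp: PA_complete_def computes_id_id)
next
  case (Suc m)
  let ?\<delta> = "\<lambda>n. \<phi> n n"
  have \<delta>: "partrec_in {} ?\<delta>" using \<phi> by (rule acceptable_diag)
  obtain T where T: "recf2 {} T" "stage T ?\<delta>" using stage_exists[OF \<delta>] by blast
  \<comment> \<open>If the diagonal at \<open>x\<close> were the low bit of \<open>k x y\<close> and
    the diagonal at \<open>y\<close> the remaining part, this value would be \<open>k x y\<close>
    itself, at an index where \<open>h\<close> avoids the diagonal.\<close>
  let ?\<psi> = "\<lambda>z. Option.bind (?\<delta> (pfst z)) (\<lambda>a. Option.bind (?\<delta> (psnd z)) (\<lambda>b. Some (a + 2 * b)))"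
  have "partrec_in {} (\<lambda>z. Option.bind (Option.bind (?\<delta> (pfst z))
      (\<lambda>a. Option.bind (?\<delta> (psnd z)) (\<lambda>b. Some (prod_encode (a, b)))))
      (\<lambda>p. Some (pfst p + 2 * psnd p)))"
    by (rule partrec_in.comp[OF _ partrec_in.pair])
      (intro rec_intros partrec_comp_total[OF \<delta>] | subst recf_def[symmetric])+
  then have "partrec_in {} ?\<psi>" by (simp cong: Option.bind_cong)
  then obtain t where t: "recf {} t" "\<And>z. ?\<delta> (t z) = ?\<psi> z"
    using acceptable_diag_surj[OF \<phi>] by blast
  define k where "k x y = h (t (prod_encode (x, y)))" for x y
  have k: "recf A (\<lambda>p. k (f p) (g p))" if "recf A f" "recf A g" for f g
    unfolding k_def
    by (intro rec_intros recf_app[OF Suc.prems(1)] recf_app[OF recf_mono_empty[OF t(1)]] that)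
  have avoid: "?\<delta> x \<noteq> Some (k x y mod 2) \<or> ?\<delta> y \<noteq> Some (k x y div 2)" for x y
  proof (rule ccontr)
    assume "\<not> ?thesis"
    then have "?\<delta> (t (prod_encode (x, y))) = Some (k x y)" by (simp add: t(2))
    then show False using Suc.prems(2) unfolding DNR_def k_def by blast
  qed
  show ?case
  proof (cases "\<exists>x. \<forall>y. ?\<delta> y \<noteq> Some (k x y div 2)")
    case True
    then obtain x where x: "\<And>y. ?\<delta> y \<noteq> Some (k x y div 2)" by blast
    show ?thesis
    proof (rule Suc.IH)
      show "recf A (\<lambda>y. k x y div 2)" by (intro rec_intros k)
      show "DNR \<phi> (\<lambda>y. k x y div 2)" using x by (auto simp: DNR_def)
      show "k x y div 2 < 2 ^ m" for y
        using Suc.prems(3)[of "t (prod_encode (x, y))"] by (simp add: k_def)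
    qed
  next
    case False
    \<comment> \<open>\<open>w\<close> pairs a candidate \<open>y\<close> with a stage confirming
      that the upper half is wrong at \<open>y\<close>; the search is total because no
      \<open>x\<close> makes the upper half DNR.\<close>
    define P where "P x w \<longleftrightarrow> T (pfst w) (psnd w) = Suc (k x (pfst w) div 2)" for x w
    define Y where "Y x = pfst (LEAST w. P x w)" for x
    have ex: "\<exists>w. P x w" for x
    proof -
      obtain y where "?\<delta> y = Some (k x y div 2)" using False by blast
      then obtain s where "T y s = Suc (k x y div 2)" using stage_Some_iff[OF T(2)] by blast
      then show ?thesis unfolding P_def by (intro exI[of _ "prod_encode (y, s)"]) simp
    qed
    have "dec2 A P" unfolding P_def
      by (intro rec_intros k recf2_app[OF recf_mono_empty[OF T(1)]])
    from recf_Least[OF this ex] have Y: "recf A Y" unfolding Y_def by (intro rec_intros)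
    have "?\<delta> (Y x) = Some (k x (Y x) div 2)" for x
      using LeastI_ex[OF ex[of x]] stage_Some_iff[OF T(2)] unfolding Y_def P_def by blast
    with avoid have "?\<delta> x \<noteq> Some (k x (Y x) mod 2)" for x by blast
    then have "DNR \<phi> (\<lambda>x. k x (Y x) mod 2)" by (auto simp: DNR_def)
    moreover have "recf A (\<lambda>x. k x (Y x) mod 2)" by (intro rec_intros k Y)
    moreover have "range (\<lambda>x. k x (Y x) mod 2) \<subseteq> {0, 1}" by auto
    ultimately show ?thesis by (auto simp: PA_complete_def computes_id_id)
  qed
qed

text \<open>Either \<open>h\<close> meets the diagonal infinitely often, which makes
  \<open>A\<close> high, or patching \<open>h\<close> at finitely many places makes it a bounded DNR
  function.\<close>

lemma high_or_PA_complete_if_avoids: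
  assumes \<phi>: "acceptable \<phi>" and h: "recf A h" and bound: "\<And>x. h x < 2 ^ Suc m"
    and avoid: "\<And>R. infinite R \<Longrightarrow> recursive_set R \<Longrightarrow> R \<subseteq> {n. \<phi> n n \<noteq> None} \<Longrightarrow>
      \<forall>\<^sub>\<infinity>n. n \<in> R \<longrightarrow> h n \<noteq> the (\<phi> n n)"
  shows "high A \<or> PA_complete \<phi> A"
proof -
  have "PA_complete \<phi> A" if fin: "finite {n. \<phi> n n = Some (h n)}"
  proof -
    \<comment> \<open>Subtraction is truncated, so \<open>1 - h n\<close> is 1 if
      \<open>h n = 0\<close> and 0 otherwise, always different from \<open>h n\<close>. The exponent
      \<open>Suc m\<close> leaves room for the value 1.\<close>
    define h' where "h' n = (if \<phi> n n = Some (h n) then 1 - h n else h n)" for n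
    have "{n. h n \<noteq> h' n} \<subseteq> {n. \<phi> n n = Some (h n)}" by (auto simp: h'_def)
    from recf_finite_modification[OF h finite_subset[OF this fin]] have "recf A h'" .
    moreover have "DNR \<phi> h'" unfolding DNR_def h'_def by (auto split: if_splits; arith)
    moreover have "h' x < 2 ^ Suc m" for x
    proof -
      have "1 < (2::nat) ^ Suc m" by (rule one_less_power) simp_all
      then have "1 - h x < 2 ^ Suc m" by (rule le_less_trans[OF diff_le_self])
      with bound[of x] show ?thesis by (simp add: h'_def)
    qed
    ultimately show ?thesis by (rule PA_complete_if_bounded_DNR[OF \<phi>])
  qed
  then show ?thesis using high_or_finite_agreement[OF acceptable_diag[OF \<phi>] h avoid] by blast
qed

text \<open>A 0-1-valued DNR function works as it is. In the high case the halting stage on a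
  recursive part of the domain is recursive, so a dominating \<open>f\<close> allows enough stages
  to see the diagonal value at almost all of its elements.\<close>

lemma high_or_PA_complete_imp_avoids:
  assumes \<phi>: "acceptable \<phi>" and "high A \<or> PA_complete \<phi> A"
  shows "\<exists>g. recf A g \<and> range g \<subseteq> {0, 1} \<and>
    (\<forall>R. infinite R \<and> recursive_set R \<and> R \<subseteq> {n. \<phi> n n \<noteq> None} \<longrightarrow>
      (\<forall>\<^sub>\<infinity>n. n \<in> R \<longrightarrow> g n \<noteq> the (\<phi> n n)))"
  using assms(2)
proof
  assume "PA_complete \<phi> A"
  then obtain g where g: "recf A g" "range g \<subseteq> {0, 1}" "DNR \<phi> g"
    by (auto simp: PA_complete_def computes_id_id)
  have "g n \<noteq> the (\<phi> n n)" if "R \<subseteq> {n. \<phi> n n \<noteq> None}" "n \<in> R" for n R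
    using that g(3) by (force simp: DNR_def)
  then show ?thesis using g(1,2) by (intro exI[of _ g]) auto
next
  assume "high A"
  then obtain f where f: "recf A f" "\<And>r. recf {} r \<Longrightarrow> dominates f r"
    by (auto simp: high_def computes_id_id)
  obtain T where T: "recf2 {} T" "stage T (\<lambda>n. \<phi> n n)"
    using stage_exists[OF acceptable_diag[OF \<phi>]] by blast
  \<comment> \<open>\<open>T n (f n) = 1\<close> means that the diagonal value 0 has been seen; only
    then is 1 the safe answer.\<close>
  define g where "g n = (if T n (f n) = 1 then 1 else 0 :: nat)" for n
  have "recf A g" unfolding g_def
    by (intro rec_intros recf2_app[OF recf_mono_empty[OF T(1)]] f(1))
  moreover have "\<forall>\<^sub>\<infinity>n. n \<in> R \<longrightarrow> g n \<noteq> the (\<phi> n n)"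
    if R: "recursive_set R" "R \<subseteq> {n. \<phi> n n \<noteq> None}" for R
  proof -
    \<comment> \<open>The disjunct \<open>n \<notin> R\<close> makes the search total.\<close>
    define r where "r n = (LEAST s. n \<notin> R \<or> 0 < T n s)" for n
    have ex: "\<exists>s. n \<notin> R \<or> 0 < T n s" for n
      using R(2) stage_Some_iff[OF T(2), of n]
      by (metis (mono_tags) mem_Collect_eq not_None_eq subsetD zero_less_Suc)
    have "recf {} r" unfolding r_def
      by (rule recf_Least[OF _ ex])
        (intro rec_intros recf2_app[OF T(1)] dec_app[OF R(1)[unfolded recursive_set_iff_dec]])
    from f(2)[OF this] have "\<forall>\<^sub>\<infinity>n. r n \<le> f n" by (simp add: dominates_def)
    then show ?thesis
    proof (rule MOST_mono, intro impI)
      fix n assume n: "r n \<le> f n" "n \<in> R"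
      have "n \<notin> R \<or> 0 < T n (r n)" unfolding r_def using ex by (rule LeastI_ex)
      then obtain y where y: "T n (r n) = Suc y" using n(2) gr0_conv_Suc by auto
      have "T n (f n) = Suc y" by (rule stage_mono[OF T(2) y n(1)])
      moreover have "\<phi> n n = Some y" using stage_Some_iff[OF T(2)] y by blast
      ultimately show "g n \<noteq> the (\<phi> n n)" by (auto simp: g_def)
    qed
  qed
  moreover have "range g \<subseteq> {0, 1}" by (auto simp: g_def)
  ultimately show ?thesis by blast
qed

section \<open>Complexity of string codes\<close>

text \<open>
  The strings of length \<open>n\<close> have the codes \<open>2 ^ n - 1 + v\<close> with \<open>v < 2 ^ n\<close>, where \<open>v\<close> is the string
  read in binary; so machines can be handled by arithmetic on codes.
\<close>

definition code_len :: "nat \<Rightarrow> nat" where "code_len c = (LEAST n. Suc c < 2 ^ Suc n)"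

abbreviation str_decode :: "nat \<Rightarrow> bool list" where "str_decode \<equiv> inv str_code"

lemma str_decode_code [simp]: "str_decode (str_code s) = s"
  using bij_str_code by (simp add: bij_is_inj)

lemma str_code_decode [simp]: "str_code (str_decode c) = c"
  using bij_str_code by (simp add: bij_is_surj surj_f_inv_f)

lemma str_code_bounds: "2 ^ length s \<le> Suc (str_code s) \<and> Suc (str_code s) < 2 ^ Suc (length s)"
  by (induction s) auto

lemma code_len_iff: "code_len c = n \<longleftrightarrow> 2 ^ n \<le> Suc c \<and> Suc c < 2 ^ Suc n"
proof -
  have eq: "code_len c = n" if "2 ^ n \<le> Suc c" "Suc c < 2 ^ Suc n" for n
    unfolding code_len_def
  proof (rule Least_equality)
    show "Suc c < 2 ^ Suc n" by (rule that(2))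
  next
    fix m assume "Suc c < 2 ^ Suc m"
    with that(1) have "(2::nat) ^ n < 2 ^ Suc m" by linarith
    then show "n \<le> m" by (simp only: power_strict_increasing_iff less_Suc_eq_le)
  qed
  from eq[of "length (str_decode c)"] have "code_len c = length (str_decode c)"
    using str_code_bounds[of "str_decode c"] by simp
  then show ?thesis using str_code_bounds[of "str_decode c"] eq by auto
qed

lemma code_len_str_code [simp]: "code_len (str_code s) = length s"
  using str_code_bounds code_len_iff by blast

lemma length_str_decode [simp]: "length (str_decode c) = code_len c"
  by (metis code_len_str_code str_code_decode)

lemma code_len_bounds: "2 ^ code_len c \<le> Suc c" "Suc c < 2 ^ Suc (code_len c)"
  using code_len_iff[of c "code_len c"] by auto

lemma code_len_mono: "c \<le> d \<Longrightarrow> code_len c \<le> code_len d"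
proof -
  assume "c \<le> d"
  then have "(2::nat) ^ code_len c < 2 ^ Suc (code_len d)"
    using code_len_bounds(1)[of c] code_len_bounds(2)[of d] by linarith
  then show ?thesis by (simp only: power_strict_increasing_iff less_Suc_eq_le)
qed

lemma recf_code_len: "recf A f \<Longrightarrow> recf A (\<lambda>x. code_len (f x))"
proof -
  have "dec2 A (\<lambda>c n. Suc c < 2 ^ Suc n)" by (intro rec_intros)
  moreover have "\<exists>n. Suc c < 2 ^ Suc n" for c using code_len_bounds(2) by blast
  ultimately have "recf A code_len" unfolding code_len_def by (rule recf_Least)
  then show "recf A f \<Longrightarrow> ?thesis" by (rule recf_app)
qed

lemma codes_of_len: "{c. code_len c = n} = {2 ^ n - 1..<2 ^ Suc n - 1}"
  by (auto simp: code_len_iff)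

lemma finite_codes_of_len [simp]: "finite {c. code_len c = n}"
  and card_codes_of_len: "card {c. code_len c = n} = 2 ^ n"
  by (simp_all add: codes_of_len)

lemma computes_str_id: "computes A str_code id B \<longleftrightarrow> recf A (\<lambda>c. B (str_decode c))"
proof -
  have "(\<forall>x. g (str_code x) = Some (B x)) \<longleftrightarrow> g = (\<lambda>c. Some (B (str_decode c)))" for g
    by (metis (no_types, lifting) ext str_code_decode str_decode_code)
  then show ?thesis by (simp add: computes_def computes_partial_def recf_def)
qed

lemma computes_id_str: "computes A id str_code F \<longleftrightarrow> recf A (\<lambda>n. str_code (F n))"
proof -
  have "(\<forall>x. g x = Some (str_code (F x))) \<longleftrightarrow> g = (\<lambda>x. Some (str_code (F x)))" for g by auto
  then show ?thesis by (simp add: computes_def computes_partial_def recf_def)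
qed

section \<open>Optimal machines and complexity bounds on codes\<close>

definition optimal :: "(nat \<rightharpoonup> nat) \<Rightarrow> bool" where
  "optimal u \<longleftrightarrow> partrec_in {} u \<and>
     (\<forall>v. partrec_in {} v \<longrightarrow>
        (\<exists>k. \<forall>c y. v c = Some y \<longrightarrow> (\<exists>d. u d = Some y \<and> code_len d \<le> code_len c + k)))"

text \<open>A bound on complexity is expressed by the existence of a short enough program, without
  the minimum in \<open>plain_C\<close>.\<close>

definition upper_bound :: "(nat \<rightharpoonup> nat) \<Rightarrow> (nat \<Rightarrow> nat) \<Rightarrow> bool" where
  "upper_bound u d \<longleftrightarrow> recf {} d \<and> (\<forall>y. \<exists>c. u c = Some y \<and> code_len c \<le> d y)"

lemma optimal_if_universal_machine:
  assumes "universal_machine U"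
  shows "optimal (\<lambda>c. map_option str_code (U (str_decode c)))" (is "optimal ?u")
  unfolding optimal_def
proof (intro conjI allI impI)
  obtain g where "partrec_in {} g" and g: "\<And>p. g (str_code p) = map_option str_code (U p)"
    using assms unfolding universal_machine_def computes_partial_def by blast
  moreover have "g = ?u" by (rule ext) (metis g str_code_decode)
  ultimately show "partrec_in {} ?u" by simp
  fix v assume v: "partrec_in {} v"
  define V where "V p = map_option str_decode (v (str_code p))" for p
  have "partial_recursive str_code str_code V"
    unfolding computes_partial_def V_def
    by (intro exI[of _ v]) (auto simp: v option.map_comp comp_def option.map_ident)
  then obtain k where k: "\<And>p x. V p = Some x \<Longrightarrow> \<exists>q. U q = Some x \<and> length q \<le> length p + k"
    using assms unfolding universal_machine_def by blast
  show "\<exists>k. \<forall>c y. v c = Some y \<longrightarrow> (\<exists>d. ?u d = Some y \<and> code_len d \<le> code_len c + k)"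
  proof (rule exI[of _ k], intro allI impI)
    fix c y assume "v c = Some y"
    then have "V (str_decode c) = Some (str_decode y)" by (simp add: V_def)
    from k[OF this] obtain q
      where "U q = Some (str_decode y)" "length q \<le> code_len c + k" by auto
    then show "\<exists>d. ?u d = Some y \<and> code_len d \<le> code_len c + k"
      by (intro exI[of _ "str_code q"]) simp
  qed
qed

lemma optimal_partrec: "optimal u \<Longrightarrow> partrec_in {} u"
  by (simp add: optimal_def)

lemma optimal_le:
  "optimal u \<Longrightarrow> partrec_in {} v \<Longrightarrow>
    \<exists>k. \<forall>c y. v c = Some y \<longrightarrow> (\<exists>d. u d = Some y \<and> code_len d \<le> code_len c + k)"
  by (simp only: optimal_def)

text \<open>Comparison with the identity machine: complexity is at most length plus a constant, and
  in particular every code is an output.\<close>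

lemma optimal_identity:
  assumes "optimal u"
  obtains k where "\<And>y. \<exists>c. u c = Some y \<and> code_len c \<le> code_len y + k"
proof -
  have "partrec_in {} (\<lambda>y. Some y)" using recf_id unfolding recf_def .
  from optimal_le[OF assms this] obtain k where
    k: "\<forall>c y. Some c = Some y \<longrightarrow> (\<exists>d. u d = Some y \<and> code_len d \<le> code_len c + k)" ..
  show thesis by (rule that[of k]) (rule k[rule_format, OF refl])
qed

lemma recursive_upper_bound_iff:
  assumes U: "universal_machine U"
  shows "recursive_upper_bound U D \<longleftrightarrow>
    upper_bound (\<lambda>c. map_option str_code (U (str_decode c))) (\<lambda>c. D (str_decode c))"
proof -
  obtain k where k: "\<exists>c. map_option str_code (U (str_decode c)) = Some y \<and>
      code_len c \<le> code_len y + k" for y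
    using optimal_identity[OF optimal_if_universal_machine[OF U]] by blast
  have "plain_C U x \<le> n \<longleftrightarrow>
      (\<exists>c. map_option str_code (U (str_decode c)) = Some (str_code x) \<and> code_len c \<le> n)"
    (is "?L \<longleftrightarrow> ?R") for x n
  proof
    assume ?L
    obtain c where "map_option str_code (U (str_decode c)) = Some (str_code x)"
      using k by blast
    then have "U (str_decode c) = Some x" using bij_str_code by (auto simp: bij_is_inj inj_eq)
    \<comment> \<open>Since \<open>x\<close> has a program, the minimum defining
      \<open>plain_C U x\<close> is attained.\<close>
    then have "\<exists>n p. U p = Some x \<and> length p = n" by blast
    from LeastI_ex[OF this] obtain p where p: "U p = Some x" "length p = plain_C U x"
      unfolding plain_C_def by blast
    with \<open>?L\<close> show ?R by (intro exI[of _ "str_code p"]) simp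
  next
    assume ?R
    then obtain c where "U (str_decode c) = Some x" "code_len c \<le> n"
      using bij_str_code by (auto simp: bij_is_inj inj_eq)
    moreover from this have "plain_C U x \<le> code_len c"
      unfolding plain_C_def by (intro Least_le) auto
    ultimately show ?L by simp
  qed
  moreover have "(\<forall>x. P (str_code x)) \<longleftrightarrow> (\<forall>y. P y)" for P
    by (metis str_code_decode)
  from this[of "\<lambda>y. \<exists>c. map_option str_code (U (str_decode c)) = Some y \<and>
      code_len c \<le> D (str_decode y)"]
  have "(\<forall>x. \<exists>c. map_option str_code (U (str_decode c)) = Some (str_code x) \<and> code_len c \<le> D x)
      \<longleftrightarrow> (\<forall>y. \<exists>c. map_option str_code (U (str_decode c)) = Some y \<and>
        code_len c \<le> D (str_decode y))"
    unfolding str_decode_code .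
  ultimately show ?thesis
    unfolding recursive_upper_bound_def upper_bound_def computes_str_id by simp
qed

section \<open>Bounding functions with small level sets\<close>

text \<open>Finiteness is a separate clause because \<open>card\<close> is 0 on infinite
  sets.\<close>

definition small_levels :: "(nat \<Rightarrow> nat) \<Rightarrow> bool" where
  "small_levels b \<longleftrightarrow> (\<forall>n. finite {y. b y = n} \<and> card {y. b y = n} \<le> 2 ^ n)"

lemma small_levels_if_subset:
  assumes "\<And>n. {y. b y = n} \<subseteq> S n" "\<And>n. finite (S n)" "\<And>n. card (S n) \<le> 2 ^ n"
  shows "small_levels b"
  unfolding small_levels_def using assms by (meson card_mono finite_subset le_trans)

lemma outputs_of_len:
  "finite {y. \<exists>c. code_len c = n \<and> u c = Some y}" (is "finite ?W")
  "card {y. \<exists>c. code_len c = n \<and> u c = Some y} \<le> 2 ^ n"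
proof -
  have sub: "?W \<subseteq> (\<lambda>c. the (u c)) ` {c. code_len c = n}" by force
  then show "finite ?W" by (rule finite_subset) simp
  show "card ?W \<le> 2 ^ n"
    using card_mono[OF _ sub] card_image_le[of "{c. code_len c = n}" "\<lambda>c. the (u c)"]
    by (simp add: card_codes_of_len)
qed

section \<open>Small levels from a high degree\<close>

text \<open>\<open>b y\<close> is the length of a shortest program for \<open>y\<close> found by a
  stage beyond \<open>f y\<close>. For a recursive upper bound \<open>d\<close>, the stage at which
  a program of length at most \<open>d y\<close> appears is recursive in \<open>y\<close>, hence
  almost always at most \<open>f y\<close>.\<close>

lemma high_imp_small_levels:
  assumes u: "optimal u" and "high A"
  shows "\<exists>b. recf A b \<and> small_levels b \<and> (\<forall>d. upper_bound u d \<longrightarrow> dominates d b)"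
proof -
  obtain f where f: "recf A f" "\<And>r. recf {} r \<Longrightarrow> dominates f r"
    using assms(2) by (auto simp: high_def computes_id_id)
  obtain T where T: "recf2 {} T" "stage T u"
    using stage_exists[OF optimal_partrec[OF u]] by blast
  have onto: "\<exists>c s. T c s = Suc y" for y
    using optimal_identity[OF u] stage_Some_iff[OF T(2)] by metis
  \<comment> \<open>Waiting past \<open>f y\<close> until some program for \<open>y\<close> has
    appeared makes \<open>b\<close> total.\<close>
  define \<sigma> where "\<sigma> y = (LEAST s. f y \<le> s \<and> (\<exists>c<s. T c s = Suc y))" for y
  define b where "b y = code_len (LEAST c. T c (\<sigma> y) = Suc y)" for y
  have ex_stage: "\<exists>s. m \<le> s \<and> (\<exists>c<s. T c s = Suc y)" for m y
  proof -
    obtain c s where cs: "T c s = Suc y" using onto by blast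
    let ?s = "max s (max m (Suc c))"
    have "T c ?s = Suc y" by (rule stage_max[OF T(2) cs])
    then show ?thesis by (intro exI[of _ ?s] conjI exI[of _ c]) simp_all
  qed
  have \<sigma>: "f y \<le> \<sigma> y" "\<exists>c. T c (\<sigma> y) = Suc y" for y
    using LeastI_ex[OF ex_stage[of "f y" y]] unfolding \<sigma>_def by blast+
  have \<sigma>_rec: "recf A \<sigma>" unfolding \<sigma>_def
    by (rule recf_Least[OF _ ex_stage])
      (intro rec_intros recf2_app[OF recf_mono_empty[OF T(1)]] recf_app[OF f(1)])
  have "recf A (\<lambda>y. LEAST c. T c (\<sigma> y) = Suc y)"
    by (rule recf_Least[OF _ \<sigma>(2)])
      (intro rec_intros recf2_app[OF recf_mono_empty[OF T(1)]] recf_app[OF \<sigma>_rec])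
  then have "recf A b" unfolding b_def by (rule recf_code_len)
  moreover have "small_levels b"
  proof (rule small_levels_if_subset[OF _ outputs_of_len])
    show "{y. b y = n} \<subseteq> {y. \<exists>c. code_len c = n \<and> u c = Some y}" for n
      using LeastI_ex[OF \<sigma>(2)] stage_Some_iff[OF T(2)] unfolding b_def by blast
  qed
  moreover have "dominates d b" if d: "upper_bound u d" for d
  proof -
    have drec: "recf {} d" using d by (simp add: upper_bound_def)
    define r where "r y = (LEAST s. \<exists>c<s. code_len c \<le> d y \<and> T c s = Suc y)" for y
    have ex: "\<exists>s. \<exists>c<s. code_len c \<le> d y \<and> T c s = Suc y" for y
    proof -
      obtain c where c: "u c = Some y" "code_len c \<le> d y" using d unfolding upper_bound_def by blast
      then obtain s where s: "T c s = Suc y" using stage_Some_iff[OF T(2)] by blast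
      have "T c (max s (Suc c)) = Suc y" by (rule stage_max[OF T(2) s])
      then show ?thesis
        using c(2) by (intro exI[of _ "max s (Suc c)"] exI[of _ c] conjI) simp_all
    qed
    have "recf {} r" unfolding r_def
      by (rule recf_Least[OF _ ex])
        (intro rec_intros recf2_app[OF T(1)] recf_app[OF drec] recf_code_len)
    from f(2)[OF this] have "\<forall>\<^sub>\<infinity>y. r y \<le> f y" by (simp add: dominates_def)
    then show ?thesis unfolding dominates_def
    proof (rule MOST_mono)
      fix y assume "r y \<le> f y"
      then have le: "r y \<le> \<sigma> y" using \<sigma>(1) by (rule le_trans)
      obtain c where c: "code_len c \<le> d y" "T c (r y) = Suc y"
        using LeastI_ex[OF ex[of y]] unfolding r_def by blast
      have "T c (\<sigma> y) = Suc y" by (rule stage_mono[OF T(2) c(2) le])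
      then have "(LEAST c. T c (\<sigma> y) = Suc y) \<le> c" by (rule Least_le)
      from code_len_mono[OF this] c(1) show "b y \<le> d y" unfolding b_def by simp
    qed
  qed
  ultimately show ?thesis by blast
qed

text \<open>The stage found is paired with the input, so that \<open>G\<close> can see both.\<close>

lemma partrec_search:
  assumes P: "dec2 {} P" and G: "recf2 {} G"
  shows "partrec_in {} (\<lambda>z. if \<exists>s. P z s then Some (G z (LEAST s. P z s)) else None)"
proof -
  have "partrec_in {} (\<lambda>z. Option.bind (Option.bind (Some z) (\<lambda>z'.
      Option.bind (if \<exists>s. P z s then Some (LEAST s. P z s) else None)
        (\<lambda>s. Some (prod_encode (z', s))))) (\<lambda>p. Some (G (pfst p) (psnd p))))"
    by (rule partrec_in.comp[OF G[unfolded recf_def]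
          partrec_in.pair[OF recf_id[unfolded recf_def] partrec_Least[OF P]]])
  then show ?thesis by (rule back_subst[of "partrec_in {}"]) auto
qed

section \<open>Small levels from a PA-complete degree\<close>

lemma PA_complete_imp_small_levels:
  assumes \<phi>: "acceptable \<phi>" and u: "optimal u" and PA: "PA_complete \<phi> A"
  shows "\<exists>b. recf A b \<and> small_levels b \<and> (\<forall>d. upper_bound u d \<longrightarrow> dominates d b)"
proof -
  obtain T where T: "recf2 {} T" "stage T u"
    using stage_exists[OF optimal_partrec[OF u]] by blast
  define W where "W n = {y. \<exists>c. code_len c = n \<and> u c = Some y}" for n
  have W: "finite (W n)" "card (W n) \<le> 2 ^ n" for n
    unfolding W_def by (rule outputs_of_len)+
  define w where "w n y s \<longleftrightarrow> (\<exists>c<2 ^ Suc n. code_len c = n \<and> T c s = Suc y)" for n y s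
  have w_rec: "dec {} (\<lambda>p. w (f p) (g p) (k p))"
    if "recf {} f" "recf {} g" "recf {} k" for f g k
    unfolding w_def
    by (intro rec_intros recf2_app[OF T(1)] recf_code_len
        recf_app[OF that(1)] recf_app[OF that(2)] recf_app[OF that(3)])
  have w_mono: "w n y s'" if "w n y s" "s \<le> s'" for n y s s'
    using that stage_mono[OF T(2)] unfolding w_def by blast
  have W_iff: "y \<in> W n \<longleftrightarrow> (\<exists>s. w n y s)" for n y
  proof -
    have "c < 2 ^ Suc n" if "code_len c = n" for c
      using code_len_bounds(2)[of c] that by simp
    then show ?thesis unfolding W_def w_def mem_Collect_eq stage_Some_iff[OF T(2)] by blast
  qed
  \<comment> \<open>\<open>t\<close> is a bit mask of the codes chosen so far. Counting only
    elements below \<open>s\<close> turns the cardinality into a bounded sum.\<close>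
  define Q where "Q n x t s = {y. y < s \<and> (y = x \<or> t div 2 ^ y mod 2 = 1 \<or> w n y s)}"
    for n x s and t :: nat
  define P where "P z s \<longleftrightarrow> w (pfst z) (pfst (psnd z)) s \<or>
      2 ^ pfst z < card (Q (pfst z) (pfst (psnd z)) (psnd (psnd z)) s)" for z s
  have Q_sum: "card (Q n x t s) =
      (\<Sum>y<s. of_bool (y = x \<or> t div 2 ^ y mod 2 = 1 \<or> w n y s))" for n x t s
    unfolding Q_def
    by (subst sum_of_bool_eq) (auto intro!: arg_cong[of _ _ card])
  have "dec2 {} P"
    unfolding P_def Q_sum by (intro rec_intros w_rec)
  \<comment> \<open>The wrong decision for the event seen first: 0 (leave \<open>x\<close> out) if
    \<open>x\<close> has been enumerated into \<open>W n\<close>, and 1 (take \<open>x\<close>) if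
    only the union has become too large.\<close>
  define \<psi> where "\<psi> z = (if \<exists>s. P z s
      then Some (if w (pfst z) (pfst (psnd z)) (LEAST s. P z s) then 0 else 1 :: nat) else None)" for z
  have "recf2 {} (\<lambda>z s. if w (pfst z) (pfst (psnd z)) s then 0 else 1)"
    by (intro rec_intros w_rec)
  from partrec_search[OF \<open>dec2 {} P\<close> this] have "partrec_in {} \<psi>" unfolding \<psi>_def .
  then obtain h where h: "recf A h" "\<And>z. h z = 0 \<or> h z = 1" "\<And>z. \<psi> z \<noteq> Some (h z)"
    using PA_complete_avoids[OF \<phi> PA] by blast
  \<comment> \<open>The mask of all decisions below \<open>x\<close>, each made from the mask of the
    earlier ones.\<close>
  define t where "t n x = rec_nat 0 (\<lambda>i v. v + 2 ^ i * h (prod_encode (n, prod_encode (i, v)))) x"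
    for n x
  define z where "z n x = prod_encode (n, prod_encode (x, t n x))" for n x
  define S where "S n = {x. h (z n x) = 1}" for n
  have t_rec: "recf A (\<lambda>p. t (f p) (g p))" if "recf A f" "recf A g" for f g
    unfolding t_def by (intro rec_intros recf_rec_nat recf_app[OF h(1)] recf_app[OF that(1)] that(2))
  have h0: "h (z n x) = 0" if "x \<notin> S n" for n x using h(2)[of "z n x"] that by (auto simp: S_def)
  have t_eq: "t n x = set_encode (S n \<inter> {..<x})" for n x
  proof (induction x)
    case 0
    then show ?case by (simp add: t_def)
  next
    case (Suc x)
    have step: "t n (Suc x) = t n x + 2 ^ x * h (z n x)" by (simp add: t_def z_def)
    show ?case
    proof (cases "x \<in> S n")
      case True
      then have "S n \<inter> {..<Suc x} = insert x (S n \<inter> {..<x})" by auto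
      then show ?thesis using True by (simp add: step Suc S_def)
    next
      case False
      then have "S n \<inter> {..<Suc x} = S n \<inter> {..<x}" by (auto simp: less_Suc_eq)
      then show ?thesis using h0[OF False] by (simp add: step Suc)
    qed
  qed
  have t_bit: "t n x div 2 ^ y mod 2 = 1 \<longleftrightarrow> y \<in> S n \<and> y < x" for n x y
  proof -
    have "y \<in> set_decode (t n x) \<longleftrightarrow> y \<in> S n \<and> y < x" by (simp add: t_eq)
    then show ?thesis by (simp add: set_decode_def odd_iff_mod_2_eq_one)
  qed
  let ?Q = "\<lambda>n x. insert x (S n \<inter> {..<x}) \<union> W n"
  have Q_sub: "Q n x (t n x) s \<subseteq> ?Q n x" for n x s
    unfolding Q_def t_bit by (auto simp: W_iff)
  have fin: "finite (?Q n x)" for n x using W(1) by simp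
  have \<psi>_eq: "\<psi> (z n x) = Some (if w n x s then 0 else 1)" "P (z n x) s"
    if "s = (LEAST s. P (z n x) s)" "\<exists>s. P (z n x) s" for n x s
    using that LeastI_ex[OF that(2)] by (simp_all add: \<psi>_def z_def)
  have inv: "card ((S n \<inter> {..<x}) \<union> W n) \<le> 2 ^ n" for n x
  proof (induction x)
    case 0
    then show ?case using W(2) by simp
  next
    case (Suc x)
    show ?case
    proof (cases "x \<in> S n")
      case False
      then have "S n \<inter> {..<Suc x} = S n \<inter> {..<x}" by (auto simp: less_Suc_eq)
      then show ?thesis using Suc by simp
    next
      case True
      then have eq: "(S n \<inter> {..<Suc x}) \<union> W n = ?Q n x" by auto
      have "card (?Q n x) \<le> 2 ^ n"
      proof (rule ccontr)
        assume big: "\<not> card (?Q n x) \<le> 2 ^ n"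
        \<comment> \<open>\<open>W n\<close> is finite, so a single stage sees all of it.\<close>
        have "\<exists>s. \<forall>y\<in>W n. w n y s"
          using W(1)
        proof (rule finite_subset_induct)
          show "\<exists>s. \<forall>y\<in>insert a F. w n y s"
            if aF: "a \<in> W n" "\<exists>s. \<forall>y\<in>F. w n y s" for a F
          proof -
            obtain s s' where "\<forall>y\<in>F. w n y s" "w n a s'" using aF W_iff by blast
            then have "\<forall>y\<in>insert a F. w n y (max s s')"
              using w_mono[OF _ max.cobounded1] w_mono[OF _ max.cobounded2] by blast
            then show ?thesis ..
          qed
        qed auto
        then obtain s where s: "\<forall>y\<in>W n. w n y s" ..
        \<comment> \<open>The stage must also exceed every element, because \<open>Q\<close> counts
          only elements below its stage.\<close>
        define s' where "s' = max s (Suc (Max (?Q n x)))"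
        have "y < s'" if "y \<in> ?Q n x" for y
          unfolding s'_def using Max_ge[OF fin that] by (simp add: less_max_iff_disj less_Suc_eq_le)
        moreover have "w n y s'" if "y \<in> W n" for y
          using s that w_mono[OF _ max.cobounded1] unfolding s'_def by blast
        ultimately have "?Q n x \<subseteq> Q n x (t n x) s'"
          unfolding Q_def t_bit by blast
        with Q_sub have "?Q n x = Q n x (t n x) s'" by blast
        with big have "P (z n x) s'" by (simp add: P_def z_def)
        then have ex: "\<exists>s. P (z n x) s" ..
        \<comment> \<open>For \<open>x\<close> in \<open>W n\<close> the union would not have grown.
          So the event seen is the overflow, and \<open>\<psi>\<close> forbids the decision 1 that
          \<open>h\<close> made.\<close>
        have "x \<notin> W n"
        proof
          assume "x \<in> W n"
          then have "?Q n x = (S n \<inter> {..<x}) \<union> W n" by blast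
          with big Suc show False by simp
        qed
        with \<psi>_eq(1)[OF refl ex] have "\<psi> (z n x) = Some 1" unfolding W_iff by simp
        with h(3)[of "z n x"] True show False by (simp add: S_def)
      qed
      then show ?thesis by (simp add: eq)
    qed
  qed
  have W_sub: "W n \<subseteq> S n" for n
  proof
    fix x assume x: "x \<in> W n"
    then obtain s where "w n x s" using W_iff by blast
    then have ex: "\<exists>s. P (z n x) s" by (auto simp: P_def z_def)
    \<comment> \<open>Adding an element of \<open>W n\<close> does not enlarge the union, so by
      \<open>inv\<close> the overflow never occurs and the event seen is the enumeration of
      \<open>x\<close>.\<close>
    have "w n x (LEAST s. P (z n x) s)"
    proof (rule ccontr)
      define s where "s = (LEAST s. P (z n x) s)"
      assume "\<not> w n x (LEAST s. P (z n x) s)"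
      then have "2 ^ n < card (Q n x (t n x) s)"
        using \<psi>_eq(2)[OF s_def ex] by (simp add: P_def z_def s_def)
      also have "\<dots> \<le> card (?Q n x)" by (rule card_mono[OF fin Q_sub])
      also have "?Q n x = (S n \<inter> {..<x}) \<union> W n" using x by blast
      finally show False using inv[of n x] by simp
    qed
    with \<psi>_eq(1)[OF refl ex] have "\<psi> (z n x) = Some 0" by simp
    with h(2,3)[of "z n x"] show "x \<in> S n" by (auto simp: S_def)
  qed
  \<comment> \<open>Any finite part of \<open>S n\<close> lies below some \<open>x\<close>, where
    \<open>inv\<close> applies. This yields the finiteness of \<open>S n\<close> as well.\<close>
  have S_card: "card V \<le> 2 ^ n" if "finite V" "V \<subseteq> S n" for V n
  proof -
    have "V \<subseteq> (S n \<inter> {..<Suc (Max V)}) \<union> W n"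
      using that by (auto simp: less_Suc_eq_le)
    then have "card V \<le> card ((S n \<inter> {..<Suc (Max V)}) \<union> W n)"
      by (rule card_mono[rotated]) (use W(1) in simp)
    with inv show ?thesis by (rule le_trans[rotated])
  qed
  have S_fin: "finite (S n)" for n
  proof (rule ccontr)
    assume "infinite (S n)"
    then obtain V where "V \<subseteq> S n" "finite V" "card V = Suc (2 ^ n)"
      using infinite_arbitrarily_large by blast
    with S_card[of V n] show False by simp
  qed
  define b where "b y = (LEAST n. h (z n y) = 1)" for y
  have b_le: "b y \<le> code_len c" "h (z (b y) y) = 1" if "u c = Some y" for c y
  proof -
    have "y \<in> S (code_len c)" using that W_sub W_def by blast
    then have "h (z (code_len c) y) = 1" by (simp add: S_def)
    then show "b y \<le> code_len c" "h (z (b y) y) = 1"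
      unfolding b_def by (rule Least_le, rule LeastI)
  qed
  obtain k where k: "\<And>y. \<exists>c. u c = Some y \<and> code_len c \<le> code_len y + k"
    using optimal_identity[OF u] by blast
  have "recf A b" unfolding b_def
  proof (rule recf_Least)
    show "dec2 A (\<lambda>y n. h (z n y) = 1)"
      unfolding z_def by (intro rec_intros recf_app[OF h(1)] t_rec)
    show "\<exists>n. h (z n y) = 1" for y using k[of y] b_le(2) by blast
  qed
  moreover have "small_levels b"
  proof (rule small_levels_if_subset)
    show "{y. b y = n} \<subseteq> S n" for n using k b_le(2) unfolding S_def by blast
  qed (use S_fin S_card in auto)
  moreover have "dominates d b" if "upper_bound u d" for d
    unfolding dominates_def
  proof (rule always_eventually, rule allI)
    fix y
    obtain c where "u c = Some y" "code_len c \<le> d y"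
      using \<open>upper_bound u d\<close> unfolding upper_bound_def by blast
    with b_le(1) show "b y \<le> d y" by (meson le_trans)
  qed
  ultimately show ?thesis by blast
qed

section \<open>Incompressible strings from small levels\<close>

text \<open>The levels below \<open>n\<close> have at most \<open>2 ^ n - 1\<close> elements
  together, fewer than there are codes of length \<open>n\<close>.\<close>

lemma small_levels_imp_incompressible:
  assumes b: "recf A b" "small_levels b" "\<And>d. upper_bound u d \<Longrightarrow> dominates d b"
  shows "\<exists>a. recf A a \<and> (\<forall>n. code_len (a n) = n) \<and>
    (\<forall>d. upper_bound u d \<longrightarrow> (\<forall>\<^sub>\<infinity>n. n \<le> d (a n)))"
proof -
  define a where "a n = (LEAST c. code_len c = n \<and> n \<le> b c)" for n
  have ex: "\<exists>c. code_len c = n \<and> n \<le> b c" for n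
  proof (rule ccontr)
    assume "\<not> ?thesis"
    then have sub: "{c. code_len c = n} \<subseteq> (\<Union>i<n. {c. b c = i})"
      by (auto simp: not_le)
    have "finite (\<Union>i<n. {c. b c = i})"
      using b(2) by (auto simp: small_levels_def)
    from card_mono[OF this sub] have "2 ^ n \<le> card (\<Union>i<n. {c. b c = i})"
      by (simp add: card_codes_of_len)
    also have "\<dots> \<le> (\<Sum>i<n. card {c. b c = i})" by (rule card_UN_le) simp
    also have "\<dots> \<le> (\<Sum>i<n. 2 ^ i)"
      using b(2) by (intro sum_mono) (simp add: small_levels_def)
    also have "\<dots> < 2 ^ n" by (induction n) auto
    finally show False by simp
  qed
  have "recf A a" unfolding a_def
    by (rule recf_Least[OF _ ex]) (intro rec_intros recf_code_len recf_app[OF b(1)])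
  moreover have a: "code_len (a n) = n" "n \<le> b (a n)" for n
    using LeastI_ex[OF ex[of n]] unfolding a_def by blast+
  moreover have "\<forall>\<^sub>\<infinity>n. n \<le> d (a n)" if "upper_bound u d" for d
  proof -
    have "finite {y. \<not> b y \<le> d y}"
      using b(3)[OF that] by (simp add: dominates_def eventually_cofinite)
    \<comment> \<open>The values \<open>a n\<close> have distinct lengths, so finitely many
      exceptional codes yield only finitely many exceptional \<open>n\<close>.\<close>
    moreover have "inj a" using a(1) by (metis injI)
    ultimately have "finite (a -` {y. \<not> b y \<le> d y})" by (rule finite_vimageI)
    then have "\<forall>\<^sub>\<infinity>n. b (a n) \<le> d (a n)" by (simp add: eventually_cofinite vimage_def)
    then show ?thesis by (rule MOST_mono) (meson a(2) le_trans)
  qed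
  ultimately show ?thesis by blast
qed

section \<open>Avoiding the diagonal by incompressible strings\<close>

lemma incompressible_imp_high_or_PA_complete:
  assumes \<phi>: "acceptable \<phi>" and u: "optimal u"
    and a: "recf A a" "\<And>n. code_len (a n) = n"
    and incompressible: "\<And>d. upper_bound u d \<Longrightarrow> \<forall>\<^sub>\<infinity>n. n \<le> d (a n)"
  shows "high A \<or> PA_complete \<phi> A"
proof -
  let ?\<delta> = "\<lambda>n. \<phi> n n"
  have \<delta>: "partrec_in {} ?\<delta>" using \<phi> by (rule acceptable_diag)
  obtain T where T: "recf2 {} T" "stage T ?\<delta>" using stage_exists[OF \<delta>] by blast
  \<comment> \<open>For \<open>c = 2 ^ l - 1 + r\<close> with \<open>r < 2 ^ l\<close> and
    \<open>x < 2 ^ k\<close> the output is \<open>2 ^ (l + k) - 1 + (r + 2 ^ l * x)\<close>: the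
    string coded by \<open>c\<close> followed by the \<open>k\<close> bits of \<open>x\<close>. Both
    the diagonal index and \<open>k\<close> are read off the length \<open>l\<close>.\<close>
  let ?v = "\<lambda>c. Option.bind (?\<delta> (pfst (code_len c)))
    (\<lambda>x. Some (c + 2 ^ code_len c * (2 ^ psnd (code_len c) - 1 + x)))"
  have "partrec_in {} (\<lambda>c. Option.bind (Option.bind (Some c) (\<lambda>c'.
      Option.bind (?\<delta> (pfst (code_len c))) (\<lambda>x. Some (prod_encode (c', x)))))
      (\<lambda>p. Some (pfst p + 2 ^ code_len (pfst p) * (2 ^ psnd (code_len (pfst p)) - 1 + psnd p))))"
    by (rule partrec_in.comp[OF _ partrec_in.pair[OF recf_id[unfolded recf_def]]])
      (intro rec_intros recf_code_len partrec_comp_total[OF \<delta>] | subst recf_def[symmetric])+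
  then have "partrec_in {} ?v" by (simp cong: Option.bind_cong)
  from optimal_le[OF u this] obtain j where
    j: "\<forall>c y. ?v c = Some y \<longrightarrow> (\<exists>d. u d = Some y \<and> code_len d \<le> code_len c + j)" ..
  \<comment> \<open>One more than the overhead \<open>j\<close>: an output of length
    \<open>l + k\<close> has a program of length at most \<open>l + j\<close>, which is
    shorter.\<close>
  define k where "k = Suc j"
  define l where "l e = prod_encode (e, k)" for e
  define val where "val y = y - (2 ^ code_len y - 1)" for y :: nat
  \<comment> \<open>For a code of length \<open>l + k\<close> this is the number given by its last
    \<open>k\<close> bits.\<close>
  define hi where "hi y = val y div 2 ^ (code_len y - k)" for y
  define h where "h e = hi (a (l e + k))" for e
  have short: "\<exists>d. u d = Some y \<and> code_len d < l e + k"
    if len: "code_len y = l e + k" and e: "?\<delta> e = Some (hi y)" for y e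
  proof -
    \<comment> \<open>\<open>c\<close> codes the first \<open>l e\<close> bits of \<open>y\<close>;
      the machine restores the rest from the diagonal value at \<open>e\<close>.\<close>
    define r where "r = val y mod 2 ^ l e"
    define c where "c = 2 ^ l e - 1 + r"
    have "r < 2 ^ l e" by (simp add: r_def)
    then have c: "code_len c = l e" by (simp add: code_len_iff c_def)
    have arith: "L - 1 + r + ((M - L) + H) = M - 1 + (H + r)" if "1 \<le> L" "L \<le> M" for L M H :: nat
      using that by simp
    have "2 ^ l e * (2 ^ k - 1 + hi y) = (2 ^ (l e + k) - 2 ^ l e) + 2 ^ l e * hi y"
      by (simp add: power_add add_mult_distrib2 diff_mult_distrib2)
    then have "c + 2 ^ l e * (2 ^ k - 1 + hi y) = 2 ^ (l e + k) - 1 + (2 ^ l e * hi y + r)"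
      unfolding c_def by (simp only: arith one_le_power one_le_numeral power_increasing le_add1)
    also have "2 ^ l e * hi y + r = val y" by (simp add: hi_def r_def len)
    also have "2 ^ (l e + k) - 1 + val y = y"
      using code_len_bounds(1)[of y] by (simp add: val_def len)
    finally have "c + 2 ^ l e * (2 ^ k - 1 + hi y) = y" .
    then have "?v c = Some y" by (simp add: c e l_def)
    from j[rule_format, OF this] c show ?thesis by (auto simp: k_def less_Suc_eq_le)
  qed
  obtain i where i: "\<And>y. \<exists>c. u c = Some y \<and> code_len c \<le> code_len y + i"
    using optimal_identity[OF u] by blast
  have "\<forall>\<^sub>\<infinity>e. e \<in> R \<longrightarrow> h e \<noteq> the (?\<delta> e)"
    if R: "recursive_set R" "R \<subseteq> {n. ?\<delta> n \<noteq> None}" for R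
  proof -
    \<comment> \<open>On \<open>R\<close> this is the successor of the diagonal value; off
      \<open>R\<close> the search stops at once, so \<open>\<rho>\<close> is total.\<close>
    define \<rho> where "\<rho> e = T e (LEAST s. e \<notin> R \<or> 0 < T e s)" for e
    have ex: "\<exists>s. e \<notin> R \<or> 0 < T e s" for e
      using R(2) stage_Some_iff[OF T(2), of e]
      by (metis (mono_tags) mem_Collect_eq not_None_eq subsetD zero_less_Suc)
    have dec_R: "dec {} (\<lambda>e. e \<in> R)" using R(1) by (simp add: recursive_set_iff_dec)
    have "recf {} (\<lambda>e. LEAST s. e \<notin> R \<or> 0 < T e s)"
      by (rule recf_Least[OF _ ex]) (intro rec_intros recf2_app[OF T(1)] dec_app[OF dec_R])
    from recf2_app[OF T(1) recf_id this] have \<rho>_rec: "recf {} \<rho>" unfolding \<rho>_def .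
    have \<rho>: "?\<delta> e = Some x \<longleftrightarrow> \<rho> e = Suc x" if "e \<in> R" for e x
    proof -
      have "0 < \<rho> e" using LeastI_ex[OF ex[of e]] that unfolding \<rho>_def by blast
      then obtain y where y: "\<rho> e = Suc y" using gr0_conv_Suc by blast
      then have "\<exists>s. T e s = Suc y" unfolding \<rho>_def ..
      then have "?\<delta> e = Some y" by (simp only: stage_Some_iff[OF T(2)])
      with y show ?thesis by auto
    qed
    define E where "E y = pfst (code_len y - k)" for y
    \<comment> \<open>Codes ending in the diagonal value at some \<open>e\<close> in
      \<open>R\<close> save a bit by \<open>short\<close>, and are recognizable because
      \<open>R\<close> and \<open>\<rho>\<close> are recursive. All others get the bound from the
      identity machine.\<close>
    define d where "d y = (if E y \<in> R \<and> code_len y = l (E y) + k \<and> \<rho> (E y) = Suc (hi y)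
        then code_len y - 1 else code_len y + i)" for y
    have "upper_bound u d" unfolding upper_bound_def
    proof
      show "recf {} d"
        unfolding d_def E_def hi_def val_def l_def
        by (intro rec_intros recf_code_len recf_app[OF \<rho>_rec] dec_app[OF dec_R])
      show "\<forall>y. \<exists>c. u c = Some y \<and> code_len c \<le> d y"
      proof
        fix y
        show "\<exists>c. u c = Some y \<and> code_len c \<le> d y"
        proof (cases "E y \<in> R \<and> code_len y = l (E y) + k \<and> \<rho> (E y) = Suc (hi y)")
          case True
          then obtain c where "u c = Some y" "code_len c < code_len y"
            using short[of y "E y"] \<rho> by auto
          with True show ?thesis by (intro exI[of _ c]) (auto simp: d_def)
        next
          case False
          with i[of y] show ?thesis unfolding d_def if_not_P[OF False] by simp
        qed
      qed
    qed
    from incompressible[OF this] obtain N where N: "\<And>n. n \<ge> N \<Longrightarrow> n \<le> d (a n)"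
      unfolding MOST_nat_le by blast
    have "h e \<noteq> the (?\<delta> e)" if "e \<ge> N" "e \<in> R" for e
    proof
      assume eq: "h e = the (?\<delta> e)"
      let ?y = "a (l e + k)"
      have E: "E ?y = e" by (simp add: E_def a(2) l_def)
      have "?\<delta> e = Some (hi ?y)" using eq R(2) that(2) by (auto simp: h_def)
      then have "d ?y = l e + k - 1" using \<rho>[OF that(2)] that(2) by (simp add: d_def E a(2))
      \<comment> \<open>The length \<open>l e + k\<close> is at least \<open>e\<close>, so it lies
        in the range where incompressibility holds.\<close>
      moreover have "N \<le> l e + k"
        using that(1) le_prod_encode_1[of e k] by (simp add: l_def)
      ultimately show False using N[of "l e + k"] by (simp add: k_def)
    qed
    then show ?thesis unfolding MOST_nat_le by blast
  qed
  moreover have "h e < 2 ^ Suc j" for e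
  proof -
    have "val (a (l e + k)) < 2 ^ (l e + k)"
      using code_len_bounds[of "a (l e + k)"] by (simp add: val_def a(2))
    also have "\<dots> = 2 ^ k * 2 ^ l e" by (simp add: power_add)
    finally show ?thesis
      by (simp only: h_def hi_def a(2) add_diff_cancel_right' k_def[symmetric]
          div_less_iff_less_mult zero_less_power zero_less_numeral)
  qed
  moreover have "recf A h"
    unfolding h_def hi_def val_def l_def by (intro rec_intros recf_code_len recf_app[OF a(1)])
  ultimately show ?thesis by (intro high_or_PA_complete_if_avoids[OF \<phi>]) auto
qed

section \<open>Equivalence of the four conditions, transferred between strings and codes\<close>

theorem theorem5p2:
  fixes \<phi> :: "nat \<Rightarrow> nat \<rightharpoonup> nat"
    and U :: "bool list \<rightharpoonup> bool list"
    and A :: "nat set"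
  assumes "acceptable \<phi>"
    and "universal_machine U"
  shows
    "((high A \<or> PA_complete \<phi> A) \<longleftrightarrow>
       (\<exists>B :: bool list \<Rightarrow> nat. computes A str_code id B \<and>
         (\<forall>n. finite {x. B x = n} \<and> card {x. B x = n} \<le> 2 ^ n) \<and>
         (\<forall>D. recursive_upper_bound U D \<longrightarrow> dominates D B))) \<and>
     ((high A \<or> PA_complete \<phi> A) \<longleftrightarrow>
       (\<exists>F :: nat \<Rightarrow> bool list. computes A id str_code F \<and>
         (\<forall>n. length (F n) = n) \<and>
         (\<forall>D. recursive_upper_bound U D \<longrightarrow> (\<forall>\<^sub>\<infinity>n. D (F n) \<ge> n)))) \<and>
     ((high A \<or> PA_complete \<phi> A) \<longleftrightarrow>
       (\<exists>g :: nat \<Rightarrow> nat. computes A id id g \<and> range g \<subseteq> {0, 1} \<and>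
         (\<forall>R. infinite R \<and> recursive_set R \<and> R \<subseteq> {n. \<phi> n n \<noteq> None} \<longrightarrow>
            (\<forall>\<^sub>\<infinity>n. n \<in> R \<longrightarrow> g n \<noteq> the (\<phi> n n)))))"
    (is "(?one \<longleftrightarrow> ?two) \<and> (_ \<longleftrightarrow> ?three) \<and> (_ \<longleftrightarrow> ?four)")
proof -
  define u where "u = (\<lambda>c. map_option str_code (U (str_decode c)))"
  have u: "optimal u" unfolding u_def using assms(2) by (rule optimal_if_universal_machine)
  have bound: "recursive_upper_bound U D \<longleftrightarrow> upper_bound u (\<lambda>c. D (str_decode c))" for D
    unfolding u_def by (rule recursive_upper_bound_iff[OF assms(2)])
  have bound': "upper_bound u d \<longleftrightarrow> recursive_upper_bound U (\<lambda>x. d (str_code x))" for d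
    by (simp add: bound)
  have two: ?two if hyp: ?one
  proof -
    obtain b where b: "recf A b" "small_levels b" "\<And>d. upper_bound u d \<Longrightarrow> dominates d b"
      using hyp high_imp_small_levels[OF u] PA_complete_imp_small_levels[OF assms(1) u] by blast
    have vimage: "{x. P (str_code x)} = str_code -` {y. P y}" for P by auto
    have inj: "inj str_code" using bij_str_code by (rule bij_is_inj)
    show ?two
    proof (intro exI conjI allI impI)
      show "computes A str_code id (\<lambda>x. b (str_code x))" using b(1) by (simp add: computes_str_id)
      show "finite {x. b (str_code x) = n}" for n
        unfolding vimage[of "\<lambda>y. b y = n"] using b(2) inj
        by (intro finite_vimageI) (simp_all add: small_levels_def)
      show "card {x. b (str_code x) = n} \<le> 2 ^ n" for n
        unfolding vimage[of "\<lambda>y. b y = n"] using b(2) bij_str_code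
        by (subst card_vimage_inj) (auto simp: small_levels_def bij_def)
      show "dominates D (\<lambda>x. b (str_code x))" if "recursive_upper_bound U D" for D
      proof -
        \<comment> \<open>Domination transfers along the injective coding, since the finite
          exceptional set has a finite preimage.\<close>
        have "finite {y. \<not> b y \<le> D (str_decode y)}"
          using b(3) that unfolding bound by (simp add: dominates_def eventually_cofinite)
        from finite_vimageI[OF this inj] show ?thesis
          by (simp add: dominates_def eventually_cofinite vimage_def)
      qed
    qed
  qed
  have three: ?three if hyp: ?two
  proof -
    obtain B where B: "computes A str_code id B"
        "\<And>n. finite {x. B x = n} \<and> card {x. B x = n} \<le> 2 ^ n"
        "\<And>D. recursive_upper_bound U D \<Longrightarrow> dominates D B"
      using hyp by blast
    define b where "b c = B (str_decode c)" for c
    have vimage: "{c. P (str_decode c)} = str_decode -` {x. P x}" for P by auto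
    have bij: "bij str_decode" using bij_str_code by (rule bij_imp_bij_inv)
    have "recf A b" unfolding b_def using B(1) by (simp add: computes_str_id)
    moreover have "small_levels b"
      unfolding small_levels_def b_def
    proof (intro allI conjI)
      fix n
      show "finite {c. B (str_decode c) = n}"
        unfolding vimage[of "\<lambda>x. B x = n"] using B(2) bij
        by (intro finite_vimageI) (auto simp: bij_def)
      show "card {c. B (str_decode c) = n} \<le> 2 ^ n"
        unfolding vimage[of "\<lambda>x. B x = n"] using B(2) bij
        by (subst card_vimage_inj) (auto simp: bij_def)
    qed
    moreover have "dominates d b" if "upper_bound u d" for d
    proof -
      have "finite {x. \<not> B x \<le> d (str_code x)}"
        using B(3) that unfolding bound' by (simp add: dominates_def eventually_cofinite)
      from finite_vimageI[OF this bij_is_inj[OF bij]] show ?thesis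
        by (simp add: dominates_def b_def eventually_cofinite vimage_def)
    qed
    ultimately obtain a where a: "recf A a" "\<And>n. code_len (a n) = n"
        "\<And>d. upper_bound u d \<Longrightarrow> \<forall>\<^sub>\<infinity>n. n \<le> d (a n)"
      using small_levels_imp_incompressible by blast
    show ?three
    proof (intro exI conjI allI impI)
      show "computes A id str_code (\<lambda>n. str_decode (a n))" using a(1) by (simp add: computes_id_str)
      show "length (str_decode (a n)) = n" for n by (simp add: a(2))
      show "\<forall>\<^sub>\<infinity>n. n \<le> D (str_decode (a n))" if "recursive_upper_bound U D" for D
        using a(3) that unfolding bound by blast
    qed
  qed
  have one: ?one if hyp: ?three
  proof -
    obtain F where F: "computes A id str_code F" "\<And>n. length (F n) = n"
        "\<And>D. recursive_upper_bound U D \<Longrightarrow> \<forall>\<^sub>\<infinity>n. n \<le> D (F n)"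
      using hyp by blast
    show ?one
    proof (rule incompressible_imp_high_or_PA_complete[OF assms(1) u])
      show "recf A (\<lambda>n. str_code (F n))" using F(1) by (simp add: computes_id_str)
      show "code_len (str_code (F n)) = n" for n by (simp add: F(2))
      show "\<forall>\<^sub>\<infinity>n. n \<le> d (str_code (F n))" if "upper_bound u d" for d
        using F(3) that unfolding bound' by blast
    qed
  qed
  have four: "?one \<longleftrightarrow> ?four"
  proof
    assume ?one
    from high_or_PA_complete_imp_avoids[OF assms(1) this] show ?four
      unfolding computes_id_id .
  next
    assume ?four
    then obtain g where g: "recf A g" "range g \<subseteq> {0, 1}"
        "\<And>R. infinite R \<Longrightarrow> recursive_set R \<Longrightarrow> R \<subseteq> {n. \<phi> n n \<noteq> None} \<Longrightarrow>
          \<forall>\<^sub>\<infinity>n. n \<in> R \<longrightarrow> g n \<noteq> the (\<phi> n n)"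
      unfolding computes_id_id by blast
    have "g x < 2 ^ Suc 0" for x using g(2) by (auto simp: less_2_cases_iff)
    from high_or_PA_complete_if_avoids[OF assms(1) g(1) this g(3)] show ?one .
  qed
  have "?one \<longleftrightarrow> ?two" by (rule iffI[OF two one[OF three]])
  moreover have "?one \<longleftrightarrow> ?three" by (rule iffI[OF three[OF two] one])
  ultimately show ?thesis using four by (intro conjI)
qed

end
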